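(* Let $M$ be an oriented matroid on a linearly ordered finite set $E$. The active filtration of $M$ is a connected filtration of $M$, and it is the unique filtration $(F'_\varepsilon,\ldots,F'_0,F_c,F_0,\ldots,F_\iota)$ of $E$ (hence also the unique connected filtration of $M$) such that - for every $1\le k\le \iota$, the minor $M(F_k)/F_{k-1}$ is bounded with respect to $\min(F_k\setminus F_{k-1})$; and - for every $1\le k\le \varepsilon$, the minor $M(F'_{k-1})/F'_k$ is dual-bounded with respect to $\min(F'_{k-1}\setminus F'_k)$.
   Context: $\subset$ denotes strict inclusion. $M(F)$ denotes the restriction of $M$ to $F$ and $M/F$ the contraction of $F$; minors inherit the order of $E$. Signed circuits and cocircuits of an oriented matroid come in opposite pairs; one is positive if all its signs are positive. By abuse, a circuit or cocircuit is also identified with its support. $M$ is acyclic if it has no positive circuit (equivalently every element is in a positive cocircuit), totally cyclic if it has no positive cocircuit (equivalently every element is in a positive circuit). Bounded / dual-bounded: an oriented matroid with ground set containing $p$ is bounded with respect to $p$ if it is acyclic and every positive cocircuit contains $p$; it is dual-bounded with respect to $p$ if it is totally cyclic and every positive circuit contains $p$. Activities: $O^*(M)$ (dual-active elements) is the set of smallest elements of positive cocircuits of $M$; $O(M)$ (active elements) is the set of smallest elements of positive circuits of $M$. Filtration of $E$ (or of $M$): a sequence of subsets $(F'_\varepsilon,\ldots,F'_0,F_c,F_0,\ldots,F_\iota)$, $\iota,\varepsilon\ge 0$, with $\emptyset=F'_\varepsilon\subset\cdots\subset F'_0=F_c=F_0\subset\cdots\subset F_\iota=E$, such that $\min(F_k\setminus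 F_{k-1})$, $1\le k\le\iota$, is increasing with $k$, and $\min(F'_{k-1}\setminus F'_k)$, $1\le k\le\varepsilon$, is increasing with $k$. It is a connected filtration of $M$ if moreover for $1\le k\le\iota$ the (underlying) matroid $M(F_k)/F_{k-1}$ is connected and is not a loop, and for $1\le k\le\varepsilon$ the matroid $M(F'_{k-1})/F'_k$ is connected and is not an isthmus (here "a loop", resp. "an isthmus", means a one-element matroid whose element is a loop, resp. an isthmus; one-element matroids are connected). Active filtration of $M$: let $O^*(M)=\{a_1<\dots<a_\iota\}$ and $O(M)=\{a'_1<\dots<a'_\varepsilon\}$. It is the sequence $\emptyset=F'_\varepsilon\subset\cdots\subset F'_0=F_c=F_0\subset\cdots\subset F_\iota=E$ where $F_c$ is the union of all positive circuits of $M$ (equivalently the complement of the union of all positive cocircuits); $F'_k$ is the union of all positive circuits $C$ with $\min(C)\ge a'_{k+1}$, for $0\le k\le\varepsilon-1$; $F'_\varepsilon=\emptyset$; $F_k$ is the complement in $E$ of the union of all positive cocircuits $D$ with $\min(D)\ge a_{k+1}$, for $0\le k\le\iota-1$; $F_\iota=E$. *)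

theory Defs
  imports Main
begin

section \<open>Signed sets\<close>

text \<open>In all uses the positive and the negative part are disjoint; this is imposed where signed
  sets are collected (circuit axioms, signed cocircuits) and not by the type.\<close>

datatype 'a signed_set = SSet (pos_part: "'a set") (neg_part: "'a set")

definition supp :: "'a signed_set \<Rightarrow> 'a set" where
  "supp X = pos_part X \<union> neg_part X"

definition opposite :: "'a signed_set \<Rightarrow> 'a signed_set" where
  "opposite X = SSet (neg_part X) (pos_part X)"

definition remove_elts :: "'a signed_set \<Rightarrow> 'a set \<Rightarrow> 'a signed_set" where
  "remove_elts X A = SSet (pos_part X - A) (neg_part X - A)"

definition orthogonal :: "'a signed_set \<Rightarrow> 'a signed_set \<Rightarrow> bool" where
  "orthogonal X Y \<longleftrightarrow>
     supp X \<inter> supp Y = {} \<or>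
     ((pos_part X \<inter> pos_part Y) \<union> (neg_part X \<inter> neg_part Y) \<noteq> {} \<and>
      (pos_part X \<inter> neg_part Y) \<union> (neg_part X \<inter> pos_part Y) \<noteq> {})"


section \<open>Oriented matroids\<close>

record 'a om =
  ground :: "'a set"
  circuits :: "'a signed_set set"

text \<open>The signed circuit axioms, with weak elimination.\<close>

locale oriented_matroid =
  fixes M :: "'a om"
  assumes finite_ground: "finite (ground M)"
    and circuit_in_ground: "X \<in> circuits M \<Longrightarrow> supp X \<subseteq> ground M"
    and circuit_disjoint: "X \<in> circuits M \<Longrightarrow> pos_part X \<inter> neg_part X = {}"
    and circuit_nonempty: "X \<in> circuits M \<Longrightarrow> supp X \<noteq> {}"
    and circuit_opposite: "X \<in> circuits M \<Longrightarrow> opposite X \<in> circuits M"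
    and circuit_incomparable:
      "X \<in> circuits M \<Longrightarrow> Y \<in> circuits M \<Longrightarrow> supp X \<subseteq> supp Y \<Longrightarrow> X = Y \<or> X = opposite Y"
    and circuit_elimination:
      "X \<in> circuits M \<Longrightarrow> Y \<in> circuits M \<Longrightarrow> X \<noteq> opposite Y \<Longrightarrow>
       e \<in> pos_part X \<inter> neg_part Y \<Longrightarrow>
       \<exists>Z \<in> circuits M. pos_part Z \<subseteq> (pos_part X \<union> pos_part Y) - {e} \<and>
                       neg_part Z \<subseteq> (neg_part X \<union> neg_part Y) - {e}"


subsection \<open>Underlying matroid\<close>

definition mat_circuits :: "'a om \<Rightarrow> 'a set set" where
  "mat_circuits M = supp ` circuits M"

definition mat_indep :: "'a om \<Rightarrow> 'a set \<Rightarrow> bool" where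
  "mat_indep M I \<longleftrightarrow> I \<subseteq> ground M \<and> (\<forall>C \<in> mat_circuits M. \<not> C \<subseteq> I)"

definition mat_basis :: "'a om \<Rightarrow> 'a set \<Rightarrow> bool" where
  "mat_basis M B \<longleftrightarrow> mat_indep M B \<and> (\<forall>I. mat_indep M I \<longrightarrow> \<not> B \<subset> I)"

text \<open>The bases of the dual matroid are the complements of bases.\<close>

definition mat_coindep :: "'a om \<Rightarrow> 'a set \<Rightarrow> bool" where
  "mat_coindep M I \<longleftrightarrow> (\<exists>B. mat_basis M B \<and> I \<subseteq> ground M - B)"

definition mat_cocircuits :: "'a om \<Rightarrow> 'a set set" where
  "mat_cocircuits M =
     {D. D \<subseteq> ground M \<and> \<not> mat_coindep M D \<and> (\<forall>D'. D' \<subset> D \<longrightarrow> mat_coindep M D')}"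

definition mat_connected :: "'a om \<Rightarrow> bool" where
  "mat_connected M \<longleftrightarrow>
     (\<forall>e \<in> ground M. \<forall>f \<in> ground M. e \<noteq> f \<longrightarrow> (\<exists>C \<in> mat_circuits M. e \<in> C \<and> f \<in> C))"

definition is_a_loop :: "'a om \<Rightarrow> bool" where
  "is_a_loop M \<longleftrightarrow> (\<exists>e. ground M = {e} \<and> {e} \<in> mat_circuits M)"

definition is_an_isthmus :: "'a om \<Rightarrow> bool" where
  "is_an_isthmus M \<longleftrightarrow> (\<exists>e. ground M = {e} \<and> {e} \<in> mat_cocircuits M)"


subsection \<open>Duality and minors\<close>

text \<open>The signed cocircuits form the (unique) signature of the cocircuits of the underlying matroid
  that is orthogonal to the signed circuits.\<close>

definition cocircuits :: "'a om \<Rightarrow> 'a signed_set set" where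
  "cocircuits M =
     {Y. pos_part Y \<inter> neg_part Y = {} \<and> supp Y \<in> mat_cocircuits M \<and>
         (\<forall>X \<in> circuits M. orthogonal X Y)}"

definition restriction :: "'a om \<Rightarrow> 'a set \<Rightarrow> 'a om" where
  "restriction M F = \<lparr>ground = ground M \<inter> F, circuits = {X \<in> circuits M. supp X \<subseteq> F}\<rparr>"

definition contraction :: "'a om \<Rightarrow> 'a set \<Rightarrow> 'a om" where
  "contraction M F =
     (let S = {X. \<exists>Y \<in> circuits M. X = remove_elts Y F \<and> supp X \<noteq> {}}
      in \<lparr>ground = ground M - F, circuits = {X \<in> S. \<forall>Y \<in> S. \<not> supp Y \<subset> supp X}\<rparr>)"

abbreviation minor :: "'a om \<Rightarrow> 'a set \<Rightarrow> 'a set \<Rightarrow> 'a om" where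
  "minor M F G \<equiv> contraction (restriction M F) G"


subsection \<open>Positive circuits and cocircuits\<close>

definition pos_circuits :: "'a om \<Rightarrow> 'a set set" where
  "pos_circuits M = {supp X | X. X \<in> circuits M \<and> neg_part X = {}}"

definition pos_cocircuits :: "'a om \<Rightarrow> 'a set set" where
  "pos_cocircuits M = {supp X | X. X \<in> cocircuits M \<and> neg_part X = {}}"

definition om_acyclic :: "'a om \<Rightarrow> bool" where
  "om_acyclic M \<longleftrightarrow> pos_circuits M = {}"

definition totally_cyclic :: "'a om \<Rightarrow> bool" where
  "totally_cyclic M \<longleftrightarrow> pos_cocircuits M = {}"

definition bounded_wrt :: "'a om \<Rightarrow> 'a \<Rightarrow> bool" where
  "bounded_wrt M p \<longleftrightarrow> p \<in> ground M \<and> om_acyclic M \<and> (\<forall>D \<in> pos_cocircuits M. p \<in> D)"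

definition dual_bounded_wrt :: "'a om \<Rightarrow> 'a \<Rightarrow> bool" where
  "dual_bounded_wrt M p \<longleftrightarrow> p \<in> ground M \<and> totally_cyclic M \<and> (\<forall>C \<in> pos_circuits M. p \<in> C)"

definition active_elts :: "'a::linorder om \<Rightarrow> 'a set" where
  "active_elts M = Min ` pos_circuits M"

definition dual_active_elts :: "'a::linorder om \<Rightarrow> 'a set" where
  "dual_active_elts M = Min ` pos_cocircuits M"


section \<open>Filtrations\<close>

text \<open>A sequence \<open>(F'\<^sub>\<epsilon>, \<dots>, F'\<^sub>0, F\<^sub>c, F\<^sub>0, \<dots>, F\<^sub>\<iota>)\<close> is encoded as the triple \<open>(Fs', Fc, Fs)\<close> where
  \<open>Fs' = [F'\<^sub>0, \<dots>, F'\<^sub>\<epsilon>]\<close> (so it is listed by index, i.e. by decreasing sets) and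
  \<open>Fs = [F\<^sub>0, \<dots>, F\<^sub>\<iota>]\<close>. Thus \<open>Fs' ! k\<close> is \<open>F'\<^sub>k\<close>, \<open>Fs ! k\<close> is \<open>F\<^sub>k\<close>, and \<open>\<epsilon>\<close> and \<open>\<iota>\<close> are one less than
  the respective lengths; the index range \<open>1 \<le> k \<le> \<iota>\<close> is \<open>k \<in> {1..<length Fs}\<close>.\<close>

type_synonym 'a set_seq = "'a set list \<times> 'a set \<times> 'a set list"

fun filtration :: "'a::linorder set \<Rightarrow> 'a set_seq \<Rightarrow> bool" where
  "filtration E (Fs', Fc, Fs) \<longleftrightarrow>
     Fs' \<noteq> [] \<and> Fs \<noteq> [] \<and>
     last Fs' = {} \<and> Fs' ! 0 = Fc \<and> Fc = Fs ! 0 \<and> last Fs = E \<and>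
     (\<forall>k \<in> {1..<length Fs'}. Fs' ! k \<subset> Fs' ! (k - 1)) \<and>
     (\<forall>k \<in> {1..<length Fs}. Fs ! (k - 1) \<subset> Fs ! k) \<and>
     strict_mono_on {1..<length Fs} (\<lambda>k. Min (Fs ! k - Fs ! (k - 1))) \<and>
     strict_mono_on {1..<length Fs'} (\<lambda>k. Min (Fs' ! (k - 1) - Fs' ! k))"

fun connected_filtration :: "'a::linorder om \<Rightarrow> 'a set_seq \<Rightarrow> bool" where
  "connected_filtration M (Fs', Fc, Fs) \<longleftrightarrow>
     filtration (ground M) (Fs', Fc, Fs) \<and>
     (\<forall>k \<in> {1..<length Fs}.
        mat_connected (minor M (Fs ! k) (Fs ! (k - 1))) \<and>
        \<not> is_a_loop (minor M (Fs ! k) (Fs ! (k - 1)))) \<and>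
     (\<forall>k \<in> {1..<length Fs'}.
        mat_connected (minor M (Fs' ! (k - 1)) (Fs' ! k)) \<and>
        \<not> is_an_isthmus (minor M (Fs' ! (k - 1)) (Fs' ! k)))"

fun bounded_minors :: "'a::linorder om \<Rightarrow> 'a set_seq \<Rightarrow> bool" where
  "bounded_minors M (Fs', Fc, Fs) \<longleftrightarrow>
     (\<forall>k \<in> {1..<length Fs}.
        bounded_wrt (minor M (Fs ! k) (Fs ! (k - 1))) (Min (Fs ! k - Fs ! (k - 1)))) \<and>
     (\<forall>k \<in> {1..<length Fs'}.
        dual_bounded_wrt (minor M (Fs' ! (k - 1)) (Fs' ! k)) (Min (Fs' ! (k - 1) - Fs' ! k)))"

text \<open>Lists are indexed from 0, so \<open>a ! k\<close> and \<open>a' ! k\<close> are \<open>a\<^bsub>k+1\<^esub>\<close> and \<open>a'\<^bsub>k+1\<^esub>\<close>.\<close>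

definition active_filtration :: "'a::linorder om \<Rightarrow> 'a set_seq" where
  "active_filtration M =
     (let a = sorted_list_of_set (dual_active_elts M);
          a' = sorted_list_of_set (active_elts M);
          \<iota> = length a;
          \<epsilon> = length a'
      in (map (\<lambda>k. if k < \<epsilon> then \<Union>{C \<in> pos_circuits M. a' ! k \<le> Min C} else {}) [0..<\<epsilon> + 1],
          \<Union>(pos_circuits M),
          map (\<lambda>k. if k < \<iota> then ground M - \<Union>{D \<in> pos_cocircuits M. a ! k \<le> Min D}
                   else ground M) [0..<\<iota> + 1]))"

end

theory Submission
  imports Defs
begin

text \<open>
  A set \<open>D\<close> of elements is a positive covector if every circuit that meets \<open>D\<close> has both signs on
  \<open>D\<close>. Positive covectors are exactly the unions of positive cocircuits, and the complement of the
  union of all positive circuits is the largest one; so everything can be read off the signed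
  circuits, given strong elimination.

  For a filtration, the minors \<open>M(F\<^sub>k)/F\<^sub>k\<^sub>-\<^sub>1\<close> are bounded with respect to
  \<open>p\<^sub>k = min (F\<^sub>k - F\<^sub>k\<^sub>-\<^sub>1)\<close> if and only if all complements \<open>E - F\<^sub>k\<close> are unions of positive
  cocircuits of \<open>M\<close> and every positive cocircuit inside \<open>E - F\<^sub>k\<^sub>-\<^sub>1\<close> but not inside \<open>E - F\<^sub>k\<close>
  contains \<open>p\<^sub>k\<close>. Since the \<open>p\<^sub>k\<close> increase, \<open>p\<^sub>k\<close> is then the minimum of such a cocircuit, so
  the \<open>p\<^sub>k\<close> are the dual-active elements and they determine the \<open>F\<^sub>k\<close>. The other half is the same
  argument for positive circuits. In a dual-bounded matroid every element shares a positive circuit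
  with \<open>p\<close>; in a bounded one every element lies in a positive cocircuit that also contains \<open>p\<close>,
  and any two elements of a cocircuit lie in a common circuit.
\<close>

section \<open>Strong elimination and contractions\<close>

text \<open>The separation set of oriented matroid theory; being symmetric, it lets one elimination
  rule cover both sign patterns at \<open>e\<close>.\<close>

definition sep :: "'a signed_set \<Rightarrow> 'a signed_set \<Rightarrow> 'a set" where
  "sep X Y = (pos_part X \<inter> neg_part Y) \<union> (neg_part X \<inter> pos_part Y)"

definition conformal :: "'a signed_set \<Rightarrow> 'a signed_set \<Rightarrow> bool" where
  "conformal X Y \<longleftrightarrow> pos_part X \<subseteq> pos_part Y \<and> neg_part X \<subseteq> neg_part Y"

definition eliminates :: "'a signed_set \<Rightarrow> 'a signed_set \<Rightarrow> 'a signed_set \<Rightarrow> 'a \<Rightarrow> bool" where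
  "eliminates Z X Y e \<longleftrightarrow> pos_part Z \<subseteq> (pos_part X \<union> pos_part Y) - {e} \<and>
                         neg_part Z \<subseteq> (neg_part X \<union> neg_part Y) - {e}"

lemma opposite_simps [simp]:
  "pos_part (opposite X) = neg_part X" "neg_part (opposite X) = pos_part X"
  "opposite (opposite X) = X" "supp (opposite X) = supp X"
  by (auto simp: opposite_def supp_def)

lemma remove_elts_simps [simp]:
  "pos_part (remove_elts X B) = pos_part X - B" "neg_part (remove_elts X B) = neg_part X - B"
  "supp (remove_elts X B) = supp X - B"
  by (auto simp: remove_elts_def supp_def)

lemma opposite_remove_elts: "opposite (remove_elts X B) = remove_elts (opposite X) B"
  by (simp add: opposite_def remove_elts_def)

lemma sep_commute: "sep X Y = sep Y X"
  by (auto simp: sep_def)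

lemma eliminates_commute: "eliminates Z X Y e \<longleftrightarrow> eliminates Z Y X e"
  by (auto simp: eliminates_def)

lemma signed_set_eqI: "pos_part X = pos_part Y \<Longrightarrow> neg_part X = neg_part Y \<Longrightarrow> X = Y"
  by (simp add: signed_set.expand)

lemma sep_conformal:
  assumes "conformal Z Y" "pos_part Y \<inter> neg_part Y = {}"
  shows "sep X Z = sep X Y \<inter> supp Z"
  using assms unfolding conformal_def sep_def supp_def by blast

lemma eq_iff_sep_empty:
  assumes "supp X = supp Y"
    and "pos_part X \<inter> neg_part X = {}" "pos_part Y \<inter> neg_part Y = {}"
  shows "X = Y \<longleftrightarrow> sep X Y = {}"
proof
  assume "sep X Y = {}"
  then have "pos_part X = pos_part Y" "neg_part X = neg_part Y"
    using assms unfolding sep_def supp_def by blast+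
  then show "X = Y" by (auto intro: signed_set_eqI)
qed (use assms in \<open>auto simp: sep_def supp_def\<close>)

context oriented_matroid
begin

lemma elimination:
  assumes "X \<in> circuits M" "Y \<in> circuits M" "X \<noteq> opposite Y" "e \<in> sep X Y"
  obtains Z where "Z \<in> circuits M" "eliminates Z X Y e"
proof (cases "e \<in> pos_part X \<inter> neg_part Y")
  case True
  then show ?thesis
    using circuit_elimination[OF assms(1-3) True] that unfolding eliminates_def by blast
next
  case False
  then have "e \<in> pos_part Y \<inter> neg_part X" "Y \<noteq> opposite X"
    using assms by (auto simp: sep_def)
  then show ?thesis
    using circuit_elimination[OF assms(2,1)] that unfolding eliminates_def
    by (metis Un_commute)
qed

lemma circuit_not_psubset: "X \<in> circuits M \<Longrightarrow> Y \<in> circuits M \<Longrightarrow> \<not> supp X \<subset> supp Y"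
  using circuit_incomparable[of X Y] by auto

lemma finite_supp: "X \<in> circuits M \<Longrightarrow> finite (supp X)"
  using circuit_in_ground finite_ground finite_subset by blast

lemma sep_supp: "sep X Y \<subseteq> supp X" "sep X Y \<subseteq> supp Y"
  by (auto simp: sep_def supp_def)

section \<open>Contractions, first of a single element\<close>

lemma contraction_ground [simp]: "ground (contraction M B) = ground M - B"
  by (simp add: contraction_def Let_def)

lemma contraction_circuits:
  "X \<in> circuits (contraction M B) \<longleftrightarrow>
     (\<exists>Y \<in> circuits M. X = remove_elts Y B \<and> \<not> supp Y \<subseteq> B \<and>
        (\<forall>Z \<in> circuits M. \<not> supp Z \<subseteq> B \<longrightarrow> \<not> supp Z - B \<subset> supp Y - B))"
proof -
  define S where "S = {X. \<exists>Y \<in> circuits M. X = remove_elts Y B \<and> supp X \<noteq> {}}"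
  have S: "X \<in> S \<longleftrightarrow> (\<exists>Y \<in> circuits M. X = remove_elts Y B \<and> \<not> supp Y \<subseteq> B)" for X
    unfolding S_def mem_Collect_eq by (rule bex_cong[OF refl]) auto
  have "(\<forall>Z \<in> S. \<not> supp Z \<subset> A) \<longleftrightarrow>
      (\<forall>Z \<in> circuits M. \<not> supp Z \<subseteq> B \<longrightarrow> \<not> supp Z - B \<subset> A)" for A
    using S by (metis remove_elts_simps(3))
  moreover have "X \<in> circuits (contraction M B) \<longleftrightarrow> X \<in> S \<and> (\<forall>Z \<in> S. \<not> supp Z \<subset> supp X)"
    by (simp add: contraction_def S_def)
  ultimately show ?thesis
    using S by (metis remove_elts_simps(3))
qed

text \<open>Two things can go wrong in a contraction: an eliminating circuit may vanish into
  \<open>B\<close>, or its trace outside \<open>B\<close> may not be minimal; \<open>elim\<close>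
  and \<open>conf\<close> exclude them. The rule is applied to one element with weak elimination, on
  which strong elimination is then built, and later to arbitrary \<open>B\<close> with strong
  elimination.\<close>

lemma oriented_matroid_contractionI:
  assumes elim: "\<And>X Y e. X \<in> circuits M \<Longrightarrow> Y \<in> circuits M \<Longrightarrow> e \<in> sep X Y - B \<Longrightarrow>
      remove_elts X B \<noteq> opposite (remove_elts Y B) \<Longrightarrow>
      \<exists>Z \<in> circuits M. eliminates Z X Y e \<and> \<not> supp Z \<subseteq> B"
    and conf: "\<And>Y x. Y \<in> circuits M \<Longrightarrow> x \<in> supp Y - B \<Longrightarrow>
      \<exists>W \<in> circuits (contraction M B). x \<in> supp W \<and> conformal W Y"
  shows "oriented_matroid (contraction M B)"
proof
  show "finite (ground (contraction M B))" using finite_ground by simp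
next
  fix X assume "X \<in> circuits (contraction M B)"
  then show "supp X \<subseteq> ground (contraction M B)" "pos_part X \<inter> neg_part X = {}" "supp X \<noteq> {}"
    using circuit_in_ground circuit_disjoint by (fastforce simp: contraction_circuits)+
next
  fix X assume "X \<in> circuits (contraction M B)"
  then obtain Y where Y: "Y \<in> circuits M" "X = remove_elts Y B" "\<not> supp Y \<subseteq> B"
      "\<forall>Z \<in> circuits M. \<not> supp Z \<subseteq> B \<longrightarrow> \<not> supp Z - B \<subset> supp Y - B"
    unfolding contraction_circuits by blast
  show "opposite X \<in> circuits (contraction M B)"
    unfolding contraction_circuits
    by (rule bexI[of _ "opposite Y"]) (use Y circuit_opposite in \<open>auto simp: opposite_remove_elts\<close>)
next
  fix X Y assume "X \<in> circuits (contraction M B)" "Y \<in> circuits (contraction M B)"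
    and sub: "supp X \<subseteq> supp Y"
  then obtain X' Y' where X: "X' \<in> circuits M" "X = remove_elts X' B" "\<not> supp X' \<subseteq> B"
    and Y: "Y' \<in> circuits M" "Y = remove_elts Y' B"
    and min: "\<forall>Z \<in> circuits M. \<not> supp Z \<subseteq> B \<longrightarrow> \<not> supp Z - B \<subset> supp Y' - B"
    unfolding contraction_circuits by blast
  have eq: "supp X = supp Y" using min X Y sub by auto
  show "X = Y \<or> X = opposite Y"
  proof (rule ccontr)
    assume neg: "\<not> (X = Y \<or> X = opposite Y)"
    have "sep X Y \<noteq> {}"
      using neg eq_iff_sep_empty[OF eq] circuit_disjoint X Y by auto
    then obtain e where e: "e \<in> sep X Y" by blast
    then have "e \<in> sep X' Y' - B" using X Y by (auto simp: sep_def)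
    \<comment> \<open>The trace of \<open>Z\<close> lies inside \<open>supp Y\<close> and lacks
      \<open>e\<close>, against minimality.\<close>
    then obtain Z where Z: "Z \<in> circuits M" "eliminates Z X' Y' e" "\<not> supp Z \<subseteq> B"
      using elim[OF X(1) Y(1)] X Y neg by blast
    have "supp Z - B \<subseteq> supp Y - {e}"
      using Z eq X Y unfolding eliminates_def supp_def by auto
    moreover have "e \<in> supp Y" using e by (auto simp: sep_def supp_def)
    ultimately show False using min Z Y by auto
  qed
next
  fix X Y e assume XY: "X \<in> circuits (contraction M B)" "Y \<in> circuits (contraction M B)"
    and neg: "X \<noteq> opposite Y" and e: "e \<in> pos_part X \<inter> neg_part Y"
  obtain X' Y' where X: "X' \<in> circuits M" "X = remove_elts X' B"
    and Y: "Y' \<in> circuits M" "Y = remove_elts Y' B"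
    using XY unfolding contraction_circuits by blast
  have "e \<in> sep X' Y' - B" using X Y e by (auto simp: sep_def)
  then obtain Z where Z: "Z \<in> circuits M" "eliminates Z X' Y' e" "\<not> supp Z \<subseteq> B"
    using elim[OF X(1) Y(1)] X Y neg by blast
  then obtain x where "x \<in> supp Z - B" by blast
  then obtain W where W: "W \<in> circuits (contraction M B)" "conformal W Z"
    using conf Z by blast
  moreover have "supp W \<inter> B = {}" using W(1) by (auto simp: contraction_circuits)
  ultimately show "\<exists>Z\<in>circuits (contraction M B).
        pos_part Z \<subseteq> pos_part X \<union> pos_part Y - {e} \<and> neg_part Z \<subseteq> neg_part X \<union> neg_part Y - {e}"
    using Z X Y unfolding conformal_def eliminates_def supp_def
    by (intro bexI[of _ W]) auto
qed

text \<open>A smaller trace would come from a circuit properly inside \<open>X\<close>, because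
  \<open>X\<close> contains \<open>b\<close>.\<close>

lemma circuit_contraction1:
  assumes "X \<in> circuits M" "b \<in> supp X" "supp X \<noteq> {b}"
  shows "remove_elts X {b} \<in> circuits (contraction M {b})"
  unfolding contraction_circuits
proof (rule bexI[of _ X], intro conjI ballI impI)
  fix Z assume Z: "Z \<in> circuits M"
  show "\<not> supp Z - {b} \<subset> supp X - {b}"
    using circuit_not_psubset[OF Z assms(1)] assms(2) by blast
qed (use assms in auto)

text \<open>Eliminating \<open>V\<close> against \<open>Y\<close> at a separating element shrinks
  the separation set. The result still contains \<open>b\<close>, since otherwise it would lie
  properly inside \<open>Y\<close>, and \<open>b\<close> keeps its sign because \<open>b\<close> is
  not in \<open>Y\<close>.\<close>

lemma conformal_circuit_with_sign:
  assumes Y: "Y \<in> circuits M" "b \<notin> supp Y"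
    and V: "V \<in> circuits M" "b \<in> supp V" "supp V \<subseteq> insert b (supp Y)"
  shows "\<exists>W \<in> circuits M. supp W \<subseteq> insert b (supp Y) \<and> sep W Y = {} \<and>
    (b \<in> pos_part V \<longrightarrow> b \<in> pos_part W) \<and> (b \<in> neg_part V \<longrightarrow> b \<in> neg_part W)"
  using V
proof (induction "card (sep V Y)" arbitrary: V rule: less_induct)
  case less
  show ?case
  proof (cases "sep V Y = {}")
    case True
    then show ?thesis using less.prems by blast
  next
    case False
    then obtain h where h: "h \<in> sep V Y" by blast
    have "V \<noteq> opposite Y" using less.prems Y by auto
    then obtain Z where Z: "Z \<in> circuits M" "eliminates Z V Y h"
      using elimination h less.prems Y by blast
    have sub: "supp Z \<subseteq> insert b (supp Y) - {h}"
      using Z less.prems unfolding eliminates_def supp_def by auto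
    have "h \<in> supp Y" using h by (auto simp: sep_def supp_def)
    then have b: "b \<in> supp Z"
      using sub circuit_not_psubset[OF Z(1) Y(1)] by blast
    have "sep Z Y \<subseteq> sep V Y - {h}"
      using Z circuit_disjoint[OF Y(1)] unfolding eliminates_def sep_def by blast
    moreover have "finite (sep V Y)"
      using finite_supp[OF Y(1)] finite_subset sep_supp by metis
    ultimately have "card (sep Z Y) < card (sep V Y)"
      using h by (metis Diff_subset card_seteq Diff_iff insertI1 not_le subset_iff subset_trans)
    from less.hyps[OF this Z(1) b] sub
    obtain W where W: "W \<in> circuits M" "supp W \<subseteq> insert b (supp Y)" "sep W Y = {}"
      "b \<in> pos_part Z \<longrightarrow> b \<in> pos_part W" "b \<in> neg_part Z \<longrightarrow> b \<in> neg_part W" by blast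
    have "b \<in> pos_part V \<longrightarrow> b \<in> pos_part Z" "b \<in> neg_part V \<longrightarrow> b \<in> neg_part Z"
      using b Z(2) Y(2) circuit_disjoint[OF less.prems(1)] unfolding eliminates_def supp_def by auto
    then show ?thesis using W by blast
  qed
qed


text \<open>If \<open>Y\<close> avoids \<open>b\<close> and its trace is not minimal, there are two
  circuits through \<open>b\<close>, with opposite signs at \<open>b\<close> and conformal to
  \<open>Y\<close> elsewhere. If both missed \<open>x\<close>, eliminating \<open>b\<close> would
  give a circuit inside \<open>Y\<close> without \<open>x\<close>.\<close>

lemma conformal_circuit_contraction1:
  assumes Y: "Y \<in> circuits M" and x: "x \<in> supp Y - {b}" and b: "\<And>Z. Z \<in> circuits M \<Longrightarrow> supp Z \<noteq> {b}"
  shows "\<exists>W \<in> circuits (contraction M {b}). x \<in> supp W \<and> conformal W Y"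
proof (cases "b \<in> supp Y \<or> remove_elts Y {b} \<in> circuits (contraction M {b})")
  case True
  then have "remove_elts Y {b} \<in> circuits (contraction M {b})"
    using circuit_contraction1[OF Y] b[OF Y] by blast
  then show ?thesis
    using x by (intro bexI[of _ "remove_elts Y {b}"]) (auto simp: conformal_def)
next
  case False
  have subset_b: "b \<in> supp Z" if "Z \<in> circuits M" "supp Z \<subseteq> insert b (supp Y)" "h \<in> supp Y" "h \<notin> supp Z"
    for Z h using circuit_not_psubset[OF that(1) Y] that by blast
  obtain V where V: "V \<in> circuits M" "\<not> supp V \<subseteq> {b}" "supp V - {b} \<subset> supp Y - {b}"
    using False Y x unfolding contraction_circuits by blast
  then have V': "supp V \<subseteq> insert b (supp Y)" "b \<in> supp V"
    using circuit_not_psubset[OF V(1) Y] by auto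
  obtain W where W: "W \<in> circuits M" "supp W \<subseteq> insert b (supp Y)" "sep W Y = {}" "b \<in> supp W"
    using conformal_circuit_with_sign[OF Y _ V(1) V'(2,1)] False V'(2) unfolding supp_def by blast
  have conf: "\<exists>W \<in> circuits (contraction M {b}). x \<in> supp W \<and> conformal W Y"
    if U: "U \<in> circuits M" "supp U \<subseteq> insert b (supp Y)" "sep U Y = {}" "b \<in> supp U" "x \<in> supp U" for U
  proof (rule bexI)
    show "remove_elts U {b} \<in> circuits (contraction M {b})"
      using circuit_contraction1 U b by blast
    show "x \<in> supp (remove_elts U {b}) \<and> conformal (remove_elts U {b}) Y"
      using U x unfolding conformal_def sep_def supp_def by auto
  qed
  show ?thesis
  proof (cases "x \<in> supp W")
    case True
    then show ?thesis using conf W by blast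
  next
    case x_W: False
    obtain h where h: "h \<in> supp W" "h \<noteq> b" using b[OF W(1)] W(4) by blast
    \<comment> \<open>\<open>opposite W\<close> disagrees with \<open>Y\<close> on all of
      \<open>W\<close> except \<open>b\<close>; eliminating at \<open>h\<close> yields a circuit
      whose sign at \<open>b\<close> is opposite to that in \<open>W\<close>.\<close>
    have "h \<in> sep (opposite W) Y" using h W(2,3) unfolding sep_def supp_def by auto
    moreover have "opposite W \<noteq> opposite Y" using W False by (metis opposite_simps(3))
    ultimately obtain V2 where V2: "V2 \<in> circuits M" "eliminates V2 (opposite W) Y h"
      using elimination circuit_opposite W Y by metis
    have V2': "supp V2 \<subseteq> insert b (supp Y)" "h \<notin> supp V2"
      using V2(2) W(2) unfolding eliminates_def supp_def by auto
    then have "b \<in> supp V2" using subset_b[OF V2(1) _ _ V2'(2)] h W by blast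
    then obtain U where U: "U \<in> circuits M" "supp U \<subseteq> insert b (supp Y)" "sep U Y = {}"
       "b \<in> pos_part V2 \<longrightarrow> b \<in> pos_part U" "b \<in> neg_part V2 \<longrightarrow> b \<in> neg_part U" "b \<in> supp U"
      using conformal_circuit_with_sign[OF Y _ V2(1) _ V2'(1)] False unfolding supp_def by blast
    have bU: "b \<in> sep U W"
      using \<open>b \<in> supp V2\<close> U(4,5) W(4) V2(2) False circuit_disjoint[OF W(1)]
      unfolding eliminates_def sep_def supp_def by auto
    have "x \<in> supp U"
    proof (rule ccontr)
      assume x_U: "x \<notin> supp U"
      have "U \<noteq> opposite W"
      proof
        assume "U = opposite W"
        then have "sep (opposite W) Y = {}" using U(3) by simp
        then show False using h W(2,3) unfolding sep_def supp_def by auto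
      qed
      then obtain Z where Z: "Z \<in> circuits M" "eliminates Z U W b"
        using elimination U W bU by metis
      have "supp Z \<subseteq> supp Y - {x}"
        using Z(2) U(2) W(2) x_U x_W unfolding eliminates_def supp_def by auto
      then show False using circuit_not_psubset[OF Z(1) Y] x by blast
    qed
    then show ?thesis using conf U by blast
  qed
qed

text \<open>Since \<open>b\<close> is not a loop, no circuit produced by elimination disappears
  under the contraction.\<close>

lemma oriented_matroid_contraction1:
  assumes b: "\<And>Z. Z \<in> circuits M \<Longrightarrow> supp Z \<noteq> {b}"
  shows "oriented_matroid (contraction M {b})"
proof (rule oriented_matroid_contractionI)
  fix X Y e
  assume XY: "X \<in> circuits M" "Y \<in> circuits M" "e \<in> sep X Y - {b}"
    and neq: "remove_elts X {b} \<noteq> opposite (remove_elts Y {b})"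
  have "X \<noteq> opposite Y" using neq by (auto simp: opposite_remove_elts)
  then obtain Z where "Z \<in> circuits M" "eliminates Z X Y e"
    using elimination XY by blast
  then show "\<exists>Z\<in>circuits M. eliminates Z X Y e \<and> \<not> supp Z \<subseteq> {b}"
    using b circuit_nonempty by (metis subset_singleton_iff)
qed (use conformal_circuit_contraction1[OF _ _ b] in blast)

end

section \<open>Strong circuit elimination\<close>

text \<open>Contract an element and use induction. If \<open>X\<close> and \<open>Y\<close> also have opposite signs at some
  \<open>b \<noteq> e\<close>, the sign of \<open>b\<close> in a lift is irrelevant. Otherwise let \<open>W\<close> come from weak
  elimination and take \<open>b\<close> in \<open>W\<close> but not in \<open>Y\<close>: a lift with the wrong sign at \<open>b\<close> is
  repaired by eliminating \<open>b\<close> with \<open>W\<close>, where the union of the two circuits misses \<open>e\<close>.\<close>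

lemma strong_elimination_aux:
  assumes "oriented_matroid M" "X \<in> circuits M" "Y \<in> circuits M"
    "e \<in> sep X Y" "f \<in> supp X" "f \<notin> sep X Y"
  shows "\<exists>Z \<in> circuits M. eliminates Z X Y e \<and> f \<in> supp Z"
  using assms
proof (induction "card (supp X \<union> supp Y)" arbitrary: M X Y e rule: less_induct)
  case less
  interpret oriented_matroid M by fact
  note X = less.prems(2) and Y = less.prems(3) and e = less.prems(4) and f = less.prems(5,6)
  have fin: "finite (supp X \<union> supp Y)" using finite_supp X Y by blast
  have eXY: "e \<in> supp X" "e \<in> supp Y" using e by (auto simp: sep_def supp_def)
  have card_less: "card A < card (supp X \<union> supp Y)" if "A \<subseteq> supp X \<union> supp Y" "x \<in> supp X" "x \<notin> A" for A x
    using that fin by (intro psubset_card_mono) auto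
  \<comment> \<open>Both \<open>e\<close> and \<open>b\<close> lie in \<open>X\<close>, so a loop
    \<open>b\<close> would be a circuit properly inside \<open>X\<close>.\<close>
  have no_loop: "supp Z \<noteq> {b}" if "b \<in> supp X" "b \<noteq> e" "Z \<in> circuits M" for Z b
    using circuit_not_psubset[OF that(3) X] that(1,2) eXY by auto
  show ?case
  proof (cases "sep X Y = {e}")
    case False
    then obtain b where b: "b \<in> sep X Y" "b \<noteq> e" using e by blast
    then have bXY: "b \<in> supp X" "b \<in> supp Y" by (auto simp: sep_def supp_def)
    let ?X = "remove_elts X {b}" and ?Y = "remove_elts Y {b}"
    have sep: "sep ?X ?Y = sep X Y - {b}" by (auto simp: sep_def)
    have "supp X \<noteq> {b}" "supp Y \<noteq> {b}" "f \<noteq> b" using b f eXY by auto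
    obtain Z where Z: "Z \<in> circuits (contraction M {b})" "eliminates Z ?X ?Y e" "f \<in> supp Z"
      using less.hyps[of ?X ?Y "contraction M {b}" e] card_less[of "supp ?X \<union> supp ?Y" b]
        oriented_matroid_contraction1[OF no_loop[OF bXY(1) b(2)]]
        circuit_contraction1[OF X bXY(1)] circuit_contraction1[OF Y bXY(2)] b e f eXY bXY
        \<open>supp X \<noteq> {b}\<close> \<open>supp Y \<noteq> {b}\<close> \<open>f \<noteq> b\<close>
      unfolding sep by auto
    then obtain Z' where "Z' \<in> circuits M" "Z = remove_elts Z' {b}"
      by (auto simp: contraction_circuits)
    then show ?thesis
      using Z(2,3) b by (intro bexI[of _ Z']) (auto simp: eliminates_def sep_def)
  next
    case sep: True
    have "f \<in> sep X Y" if "X = opposite Y" using f(1) that by (auto simp: sep_def supp_def)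
    then have "X \<noteq> opposite Y" using f(2) by blast
    then obtain W where W: "W \<in> circuits M" "eliminates W X Y e"
      using elimination X Y e by blast
    show ?thesis
    proof (cases "f \<in> supp W")
      case True
      then show ?thesis using W by blast
    next
      case f_W: False
      have eW: "e \<notin> supp W" using W(2) by (auto simp: eliminates_def supp_def)
      then have "\<not> supp W \<subseteq> supp Y"
        using circuit_not_psubset[OF W(1) Y] eXY by blast
      then obtain b where b: "b \<in> supp W" "b \<notin> supp Y" by blast
      then have bX: "b \<in> supp X" "b \<noteq> e" "b \<noteq> f"
        using W(2) eW f_W by (auto simp: eliminates_def supp_def)
      let ?X = "remove_elts X {b}"
      \<comment> \<open>As \<open>Y\<close> misses \<open>b\<close>, its trace need not be a circuit
        of the contraction. A conformal circuit through \<open>e\<close> takes its place and still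
        has separation set \<open>{e}\<close> with \<open>?X\<close>.\<close>
      obtain Y' where Y': "Y' \<in> circuits (contraction M {b})" "e \<in> supp Y'" "conformal Y' Y"
        using conformal_circuit_contraction1[OF Y _ no_loop[OF bX(1,2)]] eXY(2) bX by blast
      have "sep ?X Y' = sep ?X Y \<inter> supp Y'"
        using sep_conformal Y'(3) circuit_disjoint[OF Y] by blast
      moreover have "sep ?X Y = sep X Y - {b}" by (auto simp: sep_def)
      ultimately have sep': "sep ?X Y' = {e}"
        using sep Y'(2) bX(2) by simp
      have "supp ?X \<union> supp Y' \<subseteq> supp X \<union> supp Y" "b \<notin> supp ?X \<union> supp Y'"
        using Y'(3) b(2) unfolding conformal_def supp_def by auto
      then obtain Z where Z: "Z \<in> circuits (contraction M {b})" "eliminates Z ?X Y' e" "f \<in> supp Z"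
        using less.hyps[of ?X Y' "contraction M {b}" e] card_less bX f sep sep' Y'(1)
          oriented_matroid_contraction1[OF no_loop[OF bX(1,2)]]
          circuit_contraction1[OF X bX(1) no_loop[OF bX(1,2) X]] by auto
      then obtain Z' where Z': "Z' \<in> circuits M" "Z = remove_elts Z' {b}"
        by (auto simp: contraction_circuits)
      have Z'_sub: "pos_part Z' - {b} \<subseteq> pos_part X \<union> pos_part Y - {e}"
          "neg_part Z' - {b} \<subseteq> neg_part X \<union> neg_part Y - {e}" "e \<notin> supp Z'" "f \<in> supp Z'"
        using Z(2,3) Z'(2) Y'(3) bX unfolding eliminates_def conformal_def supp_def by auto
      show ?thesis
      proof (cases "b \<in> sep Z' W")
        case True
        have "supp Z' \<union> supp W \<subseteq> supp X \<union> supp Y"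
          using Z'_sub W(2) bX unfolding eliminates_def supp_def by auto
        then have "card (supp Z' \<union> supp W) < card (supp X \<union> supp Y)"
          using card_less[of "supp Z' \<union> supp W" e] eXY eW Z'_sub by blast
        moreover have "f \<notin> sep Z' W" using f_W by (auto simp: sep_def supp_def)
        ultimately obtain V where V: "V \<in> circuits M" "eliminates V Z' W b" "f \<in> supp V"
          using less.hyps[OF _ less.prems(1) Z'(1) W(1) True] Z'_sub(4) by blast
        have "eliminates V X Y e"
          using V(2) Z'_sub W(2) unfolding eliminates_def by blast
        then show ?thesis using V by blast
      next
        case False
        \<comment> \<open>Either \<open>b\<close> is not in \<open>Z'\<close>, or it has there the
          same sign as in \<open>W\<close>, which is an allowed one.\<close>
        have "eliminates Z' X Y e"
          using Z'_sub False W(2) b bX(2) unfolding eliminates_def sep_def supp_def by blast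
        then show ?thesis using Z'(1) Z'_sub(4) by blast
      qed
    qed
  qed
qed

context oriented_matroid
begin

theorem strong_elimination:
  assumes "X \<in> circuits M" "Y \<in> circuits M" "e \<in> sep X Y" "f \<in> supp X \<union> supp Y" "f \<notin> sep X Y"
  obtains Z where "Z \<in> circuits M" "eliminates Z X Y e" "f \<in> supp Z"
  using strong_elimination_aux[OF oriented_matroid_axioms assms(1-3)]
    strong_elimination_aux[OF oriented_matroid_axioms assms(2,1), of e f] assms
  by (auto simp: sep_commute eliminates_commute)

text \<open>For supports, \<open>Y\<close> may be replaced by its opposite to make \<open>e\<close>
  separating, while \<open>f\<close>, absent from \<open>Y\<close>, never is.\<close>

lemma circuit_strong_elimination:
  assumes X: "X \<in> circuits M" and Y: "Y \<in> circuits M"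
    and e: "e \<in> supp X" "e \<in> supp Y" and f: "f \<in> supp X" "f \<notin> supp Y"
  obtains Z where "Z \<in> circuits M" "supp Z \<subseteq> supp X \<union> supp Y - {e}" "f \<in> supp Z"
proof -
  obtain Y' where Y': "Y' \<in> circuits M" "supp Y' = supp Y" "e \<in> sep X Y'"
  proof (cases "e \<in> sep X Y")
    case False
    then have "e \<in> sep X (opposite Y)" using e by (auto simp: sep_def supp_def)
    then show ?thesis using that[of "opposite Y"] Y(1) circuit_opposite by simp
  qed (use that Y in blast)
  have "f \<notin> sep X Y'" using f(2) Y'(2) by (auto simp: sep_def supp_def)
  then obtain Z where "Z \<in> circuits M" "eliminates Z X Y' e" "f \<in> supp Z"
    using strong_elimination[OF X Y'(1,3)] f(1) by blast
  moreover from this have "supp Z \<subseteq> supp X \<union> supp Y - {e}"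
    using Y'(2) unfolding eliminates_def supp_def by auto
  ultimately show thesis using that by blast
qed

section \<open>Contractions of arbitrary sets, and minors\<close>

text \<open>If the trace of \<open>Y\<close> is not minimal, it properly contains that of a circuit
  \<open>U\<close> through \<open>x\<close> with the same sign there. Choosing \<open>U\<close> with
  the fewest disagreements with \<open>Y\<close> outside \<open>B\<close> leaves none, and induction
  on the size of the trace continues with \<open>U\<close>.\<close>

lemma conformal_circuit_contraction:
  assumes "Y \<in> circuits M" "x \<in> supp Y - B"
  shows "\<exists>W \<in> circuits (contraction M B). x \<in> supp W \<and> conformal W Y"
  using assms
proof (induction "card (supp Y - B)" arbitrary: Y rule: less_induct)
  case less
  note Y = less.prems(1) and x = less.prems(2)
  have fin: "finite (supp Y - B)" using finite_supp[OF Y] by blast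
  show ?case
  proof (cases "remove_elts Y B \<in> circuits (contraction M B)")
    case True
    then show ?thesis
      using x by (intro bexI[of _ "remove_elts Y B"]) (auto simp: conformal_def)
  next
    case False
    let ?ok = "\<lambda>U. U \<in> circuits M \<and> supp U - B \<subset> supp Y - B \<and> x \<in> supp U \<and> x \<notin> sep U Y"
    have "\<exists>U. ?ok U"
    proof -
      obtain V where V: "V \<in> circuits M" "\<not> supp V \<subseteq> B" "supp V - B \<subset> supp Y - B"
        using False Y x unfolding contraction_circuits by blast
      show ?thesis
      proof (cases "x \<in> supp V")
        case True
        show ?thesis
        proof (cases "x \<in> sep V Y")
          case True
          then have "x \<notin> sep (opposite V) Y"
            using circuit_disjoint[OF V(1)] circuit_disjoint[OF Y] unfolding sep_def by auto
          then show ?thesis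
            using V \<open>x \<in> supp V\<close> circuit_opposite by (intro exI[of _ "opposite V"]) auto
        qed (use V \<open>x \<in> supp V\<close> in blast)
      next
        case x_V: False
        \<comment> \<open>If \<open>V\<close> misses \<open>x\<close>, strong elimination against
          \<open>Y\<close> brings \<open>x\<close> in and removes \<open>g\<close>, so the trace
          stays properly inside that of \<open>Y\<close>.\<close>
        obtain g where g: "g \<in> supp V" "g \<notin> B" using V by blast
        have "g \<in> supp Y" using g V(3) by blast
        then have "g \<in> sep V Y \<or> g \<in> sep (opposite V) Y"
          using g unfolding sep_def supp_def by auto
        then obtain V' where V': "V' \<in> circuits M" "supp V' = supp V" "g \<in> sep V' Y"
          using V(1) circuit_opposite by (metis opposite_simps(4))
        have "x \<notin> sep V' Y" using x_V V'(2) by (auto simp: sep_def supp_def)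
        then obtain U where U: "U \<in> circuits M" "eliminates U V' Y g" "x \<in> supp U"
          using strong_elimination[OF V'(1) Y V'(3), of x] x by blast
        have "supp U - B \<subseteq> supp Y - B - {g}"
          using U(2) V(3) V'(2) unfolding eliminates_def supp_def by blast
        moreover have "x \<notin> sep U Y"
          using U(2,3) x_V V'(2) circuit_disjoint[OF Y] unfolding eliminates_def supp_def sep_def
          by blast
        ultimately show ?thesis using U g \<open>g \<in> supp Y\<close> by blast
      qed
    qed
    then obtain U where U: "?ok U" and min: "\<And>V. ?ok V \<Longrightarrow> card (sep U Y - B) \<le> card (sep V Y - B)"
      using ex_has_least_nat[of ?ok _ "\<lambda>U. card (sep U Y - B)"] by metis
    have "sep U Y \<subseteq> B"
    proof (rule ccontr)
      assume "\<not> sep U Y \<subseteq> B"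
      then obtain h where h: "h \<in> sep U Y" "h \<notin> B" by blast
      \<comment> \<open>Eliminating with \<open>Y\<close> itself removes the disagreement at
        \<open>h\<close>, creates no new one and keeps \<open>x\<close>.\<close>
      then obtain V where V: "V \<in> circuits M" "eliminates V U Y h" "x \<in> supp V"
        using strong_elimination[of U Y h x] U Y by blast
      have hY: "h \<in> supp Y" using h by (auto simp: sep_def supp_def)
      have "supp V - B \<subseteq> supp Y - B - {h}"
        using V(2) U unfolding eliminates_def supp_def by blast
      moreover have "sep V Y \<subseteq> sep U Y - {h}"
        using V(2) circuit_disjoint[OF Y] unfolding eliminates_def sep_def by blast
      ultimately have "?ok V" "sep V Y - B \<subset> sep U Y - B"
        using V U h hY by blast+
      moreover have "finite (sep U Y - B)"
        using fin by (rule finite_subset[rotated]) (auto simp: sep_def supp_def)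
      ultimately show False using min[of V] psubset_card_mono[of "sep U Y - B" "sep V Y - B"] by simp
    qed
    have "card (supp U - B) < card (supp Y - B)"
      using U fin by (meson psubset_card_mono)
    then obtain W where W: "W \<in> circuits (contraction M B)" "x \<in> supp W" "conformal W U"
      using less.hyps[of U] U x by blast
    have "supp W \<inter> B = {}" using W(1) by (auto simp: contraction_circuits)
    moreover have "supp U - B \<subseteq> supp Y" using U by blast
    ultimately have "conformal W Y"
      using \<open>sep U Y \<subseteq> B\<close> W(3) unfolding conformal_def sep_def supp_def by blast
    then show ?thesis using W by blast
  qed
qed

text \<open>Unless the two traces are opposite, some element outside \<open>B\<close> is not
  separating. Strong elimination can keep it, so the resulting circuit survives the contraction even
  if \<open>B\<close> contains loops.\<close>

lemma oriented_matroid_contraction: "oriented_matroid (contraction M B)"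
proof (rule oriented_matroid_contractionI)
  fix X Y e
  assume X: "X \<in> circuits M" and Y: "Y \<in> circuits M" and e: "e \<in> sep X Y - B"
    and neq: "remove_elts X B \<noteq> opposite (remove_elts Y B)"
  have "\<exists>f. f \<in> supp X \<union> supp Y \<and> f \<notin> sep X Y \<and> f \<notin> B"
  proof (rule ccontr)
    assume "\<not> ?thesis"
    then have "supp X \<union> supp Y \<subseteq> sep X Y \<union> B" by blast
    then have "pos_part X - B = neg_part Y - B" "neg_part X - B = pos_part Y - B"
      using circuit_disjoint[OF X] circuit_disjoint[OF Y] unfolding sep_def supp_def by blast+
    then show False using neq by (auto intro: signed_set_eqI)
  qed
  then show "\<exists>Z\<in>circuits M. eliminates Z X Y e \<and> \<not> supp Z \<subseteq> B"
    using strong_elimination[OF X Y] e by (metis DiffD1 subsetD)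
qed (rule conformal_circuit_contraction)

lemma restriction_simps [simp]:
  "ground (restriction M A) = ground M \<inter> A"
  "circuits (restriction M A) = {X \<in> circuits M. supp X \<subseteq> A}"
  by (simp_all add: restriction_def)

lemma oriented_matroid_restriction: "oriented_matroid (restriction M A)"
proof
  fix X Y e assume "X \<in> circuits (restriction M A)" "Y \<in> circuits (restriction M A)"
      "X \<noteq> opposite Y" "e \<in> pos_part X \<inter> neg_part Y"
  moreover from this obtain Z where "Z \<in> circuits M" "pos_part Z \<subseteq> (pos_part X \<union> pos_part Y) - {e}"
      "neg_part Z \<subseteq> (neg_part X \<union> neg_part Y) - {e}"
    using circuit_elimination[of X Y e] by auto
  ultimately show "\<exists>Z\<in>circuits (restriction M A).
      pos_part Z \<subseteq> (pos_part X \<union> pos_part Y) - {e} \<and>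
      neg_part Z \<subseteq> (neg_part X \<union> neg_part Y) - {e}"
    by (intro bexI[of _ Z]) (auto simp: supp_def)
qed (use finite_ground circuit_in_ground circuit_disjoint circuit_nonempty circuit_opposite
      circuit_incomparable in auto)

lemma oriented_matroid_minor: "oriented_matroid (minor M A B)"
  using oriented_matroid.oriented_matroid_contraction oriented_matroid_restriction by blast

lemma minor_ground: "ground (minor M A B) = ground M \<inter> A - B"
  using oriented_matroid.contraction_ground[OF oriented_matroid_restriction] by auto

lemma minor_circuitE:
  assumes "X \<in> circuits (minor M A B)"
  obtains Y where "Y \<in> circuits M" "supp Y \<subseteq> A" "X = remove_elts Y B"
  using assms oriented_matroid.contraction_circuits[OF oriented_matroid_restriction] by auto

lemma minor_circuit_conformal:
  assumes "Y \<in> circuits M" "supp Y \<subseteq> A" "x \<in> supp Y - B"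
  obtains W where "W \<in> circuits (minor M A B)" "x \<in> supp W" "conformal W Y"
  using oriented_matroid.conformal_circuit_contraction[OF oriented_matroid_restriction, of Y A x B]
    assms by auto

end

section \<open>Positive vectors and covectors\<close>

text \<open>Only one implication between the signs is stated; opposite circuits supply the other.
  Cocircuits do not enter, so the notion can be followed through minors on the level of
  circuits.\<close>

definition pos_covector :: "'a om \<Rightarrow> 'a set \<Rightarrow> bool" where
  "pos_covector M D \<longleftrightarrow> D \<subseteq> ground M \<and>
     (\<forall>X \<in> circuits M. pos_part X \<inter> D \<noteq> {} \<longrightarrow> neg_part X \<inter> D \<noteq> {})"

definition pos_vector :: "'a om \<Rightarrow> 'a set \<Rightarrow> bool" where
  "pos_vector M B \<longleftrightarrow> (\<forall>x \<in> B. \<exists>C \<in> pos_circuits M. x \<in> C \<and> C \<subseteq> B)"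

lemma pos_covectorI:
  assumes "D \<subseteq> ground M"
    and "\<And>X x. X \<in> circuits M \<Longrightarrow> x \<in> pos_part X \<Longrightarrow> x \<in> D \<Longrightarrow> neg_part X \<inter> D \<noteq> {}"
  shows "pos_covector M D"
  using assms unfolding pos_covector_def by blast

context oriented_matroid
begin

lemma pos_covector_both_signs:
  assumes "pos_covector M D" "X \<in> circuits M" "x \<in> supp X" "x \<in> D"
  shows "pos_part X \<inter> D \<noteq> {}" "neg_part X \<inter> D \<noteq> {}"
proof -
  have "pos_part X \<inter> D \<noteq> {} \<longleftrightarrow> neg_part X \<inter> D \<noteq> {}"
    using assms(1) circuit_opposite[OF assms(2)] assms(2) unfolding pos_covector_def
    by (metis opposite_simps(1,2))
  then show "pos_part X \<inter> D \<noteq> {}" "neg_part X \<inter> D \<noteq> {}"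
    using assms(3,4) unfolding supp_def by blast+
qed

lemma pos_covector_not_single:
  assumes "pos_covector M D" "X \<in> circuits M"
  shows "supp X \<inter> D \<noteq> {x}"
proof
  assume x: "supp X \<inter> D = {x}"
  then have "x \<in> supp X" "x \<in> D" by auto
  then obtain a b where "a \<in> pos_part X \<inter> D" "b \<in> neg_part X \<inter> D"
    using pos_covector_both_signs[OF assms] by blast
  moreover from this have "a \<in> supp X \<inter> D" "b \<in> supp X \<inter> D" by (auto simp: supp_def)
  then have "a = x" "b = x" unfolding x by auto
  ultimately show False
    using circuit_disjoint[OF assms(2)] by blast
qed

lemma pos_covector_Union:
  assumes "\<And>D. D \<in> \<D> \<Longrightarrow> pos_covector M D"
  shows "pos_covector M (\<Union>\<D>)"
  using assms unfolding pos_covector_def by blast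

text \<open>The minor can be tested on all circuits of \<open>M\<close> inside \<open>A\<close>,
  whether or not their traces are minimal: each element of a trace lies in a conformal circuit of
  the minor, and a negative element of the latter is negative in the original circuit.\<close>

lemma pos_covector_minor:
  "pos_covector (minor M A B) D \<longleftrightarrow> D \<subseteq> ground M \<inter> A - B \<and>
     (\<forall>X \<in> circuits M. supp X \<subseteq> A \<longrightarrow> pos_part X \<inter> D \<noteq> {} \<longrightarrow> neg_part X \<inter> D \<noteq> {})"
proof (intro iffI conjI ballI impI)
  assume D: "pos_covector (minor M A B) D"
  then show "D \<subseteq> ground M \<inter> A - B"
    using minor_ground unfolding pos_covector_def by metis
  then have disj: "D \<inter> B = {}" by blast
  fix X assume X: "X \<in> circuits M" "supp X \<subseteq> A" "pos_part X \<inter> D \<noteq> {}"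
  then obtain x where x: "x \<in> pos_part X" "x \<in> D" by blast
  then have "x \<in> supp X - B" using disj by (auto simp: supp_def)
  then obtain W where W: "W \<in> circuits (minor M A B)" "x \<in> supp W" "conformal W X"
    using minor_circuit_conformal X by blast
  show "neg_part X \<inter> D \<noteq> {}"
    using oriented_matroid.pos_covector_both_signs(2)[OF oriented_matroid_minor D W(1,2) x(2)] W(3)
    unfolding conformal_def by blast
next
  assume D: "D \<subseteq> ground M \<inter> A - B \<and>
     (\<forall>X \<in> circuits M. supp X \<subseteq> A \<longrightarrow> pos_part X \<inter> D \<noteq> {} \<longrightarrow> neg_part X \<inter> D \<noteq> {})"
  show "pos_covector (minor M A B) D"
    unfolding pos_covector_def minor_ground
  proof (intro conjI ballI impI)
    show "D \<subseteq> ground M \<inter> A - B" using D by blast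
    fix X assume circ: "X \<in> circuits (minor M A B)" and X: "pos_part X \<inter> D \<noteq> {}"
    obtain Y where Y: "Y \<in> circuits M" "supp Y \<subseteq> A" "X = remove_elts Y B"
      using circ by (rule minor_circuitE)
    then have "neg_part Y \<inter> D \<noteq> {}" using D X by auto
    then show "neg_part X \<inter> D \<noteq> {}" using Y(3) D by auto
  qed
qed

section \<open>Making circuits positive, and acyclicity\<close>

text \<open>Each negative element of \<open>X\<close> lies in a positive circuit inside
  \<open>B\<close>. Eliminating it shrinks the negative part, and strong elimination keeps
  \<open>x\<close>.\<close>

lemma pos_vector_elimination:
  assumes "pos_vector M B" "X \<in> circuits M" "x \<in> supp X" "x \<notin> B" "neg_part X \<subseteq> B"
  shows "\<exists>C \<in> pos_circuits M. x \<in> C \<and> C \<subseteq> supp X \<union> B"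
  using assms(2-5)
proof (induction "card (neg_part X)" arbitrary: X rule: less_induct)
  case less
  show ?case
  proof (cases "neg_part X = {}")
    case True
    then show ?thesis using less.prems by (auto simp: pos_circuits_def)
  next
    case False
    then obtain g where g: "g \<in> neg_part X" by blast
    then obtain P where P: "P \<in> circuits M" "neg_part P = {}" "g \<in> supp P" "supp P \<subseteq> B"
      using assms(1) less.prems(4) unfolding pos_vector_def pos_circuits_def by blast
    have "g \<in> sep X P" using g P(2,3) by (auto simp: sep_def supp_def)
    moreover have "x \<notin> sep X P" using P(4) less.prems(3) by (auto simp: sep_def supp_def)
    ultimately obtain Z where Z: "Z \<in> circuits M" "eliminates Z X P g" "x \<in> supp Z"
      using strong_elimination[OF less.prems(1) P(1)] less.prems(2) by blast
    have neg: "neg_part Z \<subseteq> neg_part X - {g}" and sub: "supp Z \<subseteq> supp X \<union> B"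
      using Z(2) P(2,4) unfolding eliminates_def supp_def by auto
    have "finite (neg_part X)" using finite_supp[OF less.prems(1)] by (simp add: supp_def)
    then have "card (neg_part Z) < card (neg_part X)"
      using neg g by (intro psubset_card_mono) auto
    then obtain C where "C \<in> pos_circuits M" "x \<in> C" "C \<subseteq> supp Z \<union> B"
      using less.hyps[OF _ Z(1,3) less.prems(3)] neg less.prems(4) by blast
    then show ?thesis using sub by blast
  qed
qed

lemma pos_vector_Union: "\<C> \<subseteq> pos_circuits M \<Longrightarrow> pos_vector M (\<Union>\<C>)"
  unfolding pos_vector_def by blast

text \<open>If a circuit had a positive element \<open>x\<close> outside the union and its whole
  negative part inside, \<open>pos_vector_elimination\<close> would produce a positive circuit
  through \<open>x\<close>.\<close>

lemma pos_covector_compl_pos_circuits: "pos_covector M (ground M - \<Union>(pos_circuits M))"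
proof (rule pos_covectorI)
  fix X x assume X: "X \<in> circuits M" "x \<in> pos_part X" "x \<in> ground M - \<Union>(pos_circuits M)"
  show "neg_part X \<inter> (ground M - \<Union>(pos_circuits M)) \<noteq> {}"
  proof
    assume "neg_part X \<inter> (ground M - \<Union>(pos_circuits M)) = {}"
    then have "neg_part X \<subseteq> \<Union>(pos_circuits M)"
      using circuit_in_ground[OF X(1)] by (auto simp: supp_def)
    then show False
      using pos_vector_elimination[OF pos_vector_Union[OF subset_refl] X(1)] X(2,3)
      by (auto simp: supp_def)
  qed
qed auto

lemma pos_circuit_disjoint_pos_covector:
  assumes "C \<in> pos_circuits M" "pos_covector M D"
  shows "C \<inter> D = {}"
  using assms pos_covector_both_signs(2)[OF assms(2)] by (fastforce simp: pos_circuits_def)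

text \<open>This is the form in which acyclicity can be transferred between \<open>M\<close> and its
  minors.\<close>

lemma om_acyclic_iff: "om_acyclic M \<longleftrightarrow> pos_covector M (ground M)"
proof
  assume "om_acyclic M"
  then show "pos_covector M (ground M)"
    using pos_covector_compl_pos_circuits by (simp add: om_acyclic_def)
next
  assume *: "pos_covector M (ground M)"
  have "C \<notin> pos_circuits M" for C
  proof
    assume C: "C \<in> pos_circuits M"
    then have "C \<subseteq> ground M" "C \<noteq> {}"
      using circuit_in_ground circuit_nonempty by (auto simp: pos_circuits_def)
    then show False using pos_circuit_disjoint_pos_covector[OF C *] by blast
  qed
  then show "om_acyclic M" by (auto simp: om_acyclic_def)
qed

section \<open>Minimal positive covectors\<close>

text \<open>A Krein-Milman argument: a minimal set that contains \<open>e\<close> and whose cone contains all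
  elements must be \<open>{e}\<close>. Otherwise it contains some \<open>a \<noteq> e\<close>; the elements that are not parallel
  to \<open>a\<close> do not form a covector, which puts \<open>a\<close> into the cone of the others.\<close>

lemma parallel_if_minimal_pos_covector:
  assumes e: "e \<in> ground M" and acyc: "pos_covector M (ground M)"
    and min: "\<And>D. e \<in> D \<Longrightarrow> D \<subset> ground M \<Longrightarrow> \<not> pos_covector M D"
    and f: "f \<in> ground M" "f \<noteq> e"
  shows "SSet {e} {f} \<in> circuits M"
proof -
  have signs: "pos_part X \<noteq> {}" "neg_part X \<noteq> {}" if "X \<in> circuits M" for X
    using pos_covector_both_signs[OF acyc that] circuit_nonempty[OF that] circuit_in_ground[OF that]
    by blast+
  \<comment> \<open>In a vector picture, \<open>gen A f\<close> says that \<open>f\<close> belongs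
    to \<open>A\<close> or is a nonnegative combination of elements of \<open>A\<close>.\<close>
  define gen where "gen A f \<longleftrightarrow> f \<in> A \<or> (\<exists>X \<in> circuits M. neg_part X = {f} \<and> pos_part X \<subseteq> A)" for A f
  let ?ok = "\<lambda>A. e \<in> A \<and> A \<subseteq> ground M \<and> (\<forall>f \<in> ground M. gen A f)"
  have "?ok (ground M)" using e by (simp add: gen_def)
  then obtain A where A: "?ok A" and A_min: "\<And>B. ?ok B \<Longrightarrow> card A \<le> card B"
    using ex_has_least_nat[of ?ok _ card] by metis
  have fin_A: "finite A" using A finite_ground finite_subset by blast
  have "a = e" if a: "a \<in> A" for a
  proof (rule ccontr)
    assume ae: "a \<noteq> e"
    \<comment> \<open>The class of elements parallel to \<open>a\<close> with the same
      direction.\<close>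
    define P where "P = {f \<in> ground M. f = a \<or> SSet {a} {f} \<in> circuits M}"
    have a_ground: "a \<in> ground M" using a A by blast
    have "\<exists>X \<in> circuits M. neg_part X = {a} \<and> pos_part X \<subseteq> A - {a}"
    proof (cases "e \<in> P")
      case True
      then have "SSet {a} {e} \<in> circuits M" using ae by (simp add: P_def)
      then have "SSet {e} {a} \<in> circuits M"
        using circuit_opposite by (fastforce simp: opposite_def)
      then show ?thesis using A ae by (intro bexI[of _ "SSet {e} {a}"]) auto
    next
      case False
      \<comment> \<open>This set contains \<open>e\<close> but not \<open>a\<close>, so
        \<open>min\<close> applies and gives a circuit whose negative part lies in
        \<open>P\<close>.\<close>
      have "\<not> pos_covector M (ground M - P)"
        using False e a_ground by (intro min) (auto simp: P_def)
      then obtain X0 x where X0: "X0 \<in> circuits M" "x \<in> pos_part X0" "x \<in> ground M - P"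
          "neg_part X0 \<inter> (ground M - P) = {}"
        unfolding pos_covector_def by blast
      let ?okX = "\<lambda>X. X \<in> circuits M \<and> x \<in> pos_part X \<and> neg_part X \<subseteq> P"
      have "?okX X0" using X0 circuit_in_ground[OF X0(1)] by (auto simp: supp_def)
      then obtain X where X: "?okX X"
        and X_min: "\<And>Y. ?okX Y \<Longrightarrow> card (neg_part X - {a}) \<le> card (neg_part Y - {a})"
        using ex_has_least_nat[of ?okX _ "\<lambda>X. card (neg_part X - {a})"] by metis
      have "neg_part X \<subseteq> {a}"
      proof (rule ccontr)
        assume "\<not> neg_part X \<subseteq> {a}"
        then obtain f where f: "f \<in> neg_part X" "f \<noteq> a" by blast
        then have "SSet {a} {f} \<in> circuits M" using X by (auto simp: P_def)
        then have F: "SSet {f} {a} \<in> circuits M"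
          using circuit_opposite by (fastforce simp: opposite_def)
        have "x \<noteq> f" "x \<noteq> a" using f X X0(3) a_ground by (auto simp: P_def)
        \<comment> \<open>Eliminating against the parallel pair trades the negative element
          \<open>f\<close> for \<open>a\<close>.\<close>
        then obtain Z where Z: "Z \<in> circuits M" "eliminates Z X (SSet {f} {a}) f" "x \<in> supp Z"
          using strong_elimination[of X "SSet {f} {a}" f x] F X f by (auto simp: sep_def supp_def)
        have neg: "neg_part Z \<subseteq> insert a (neg_part X) - {f}" using Z(2) by (auto simp: eliminates_def)
        have "a \<in> P" using a_ground by (simp add: P_def)
        then have "?okX Z" using Z(1,3) neg X X0(3) unfolding supp_def by blast
        moreover have "finite (neg_part X - {a})"
          using finite_supp[of X] X by (simp add: supp_def)
        then have "card (neg_part Z - {a}) < card (neg_part X - {a})"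
          using neg f by (intro psubset_card_mono) auto
        ultimately show False using X_min[of Z] by simp
      qed
      then have neg_X: "neg_part X = {a}" using signs(2) X by blast
      \<comment> \<open>A positive element parallel to \<open>a\<close> would give a two-element
        circuit inside \<open>X\<close> that misses \<open>x\<close>.\<close>
      have "pos_part X \<inter> P = {}"
      proof (rule ccontr)
        assume "pos_part X \<inter> P \<noteq> {}"
        then obtain b where b: "b \<in> pos_part X" "b \<in> P" by blast
        then have "b \<noteq> a" using neg_X X circuit_disjoint by blast
        then have "SSet {a} {b} \<in> circuits M" using b by (simp add: P_def)
        moreover have "supp (SSet {a} {b}) \<subset> supp X"
        proof -
          have "supp (SSet {a} {b}) \<subseteq> supp X" "x \<in> supp X" "x \<notin> supp (SSet {a} {b})"
            using b neg_X X X0(3) a_ground by (auto simp: supp_def P_def)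
          then show ?thesis by blast
        qed
        ultimately show False using circuit_not_psubset X by blast
      qed
      \<comment> \<open>Positive elements outside \<open>A\<close> are now replaced by their
        generators in \<open>A\<close>. Keeping those elements out of \<open>P\<close> ensures that
        \<open>Y\<close> is never the opposite of a generating circuit.\<close>
      let ?okY = "\<lambda>Y. Y \<in> circuits M \<and> neg_part Y = {a} \<and> (pos_part Y - A) \<inter> P = {}"
      have "?okY X" using X neg_X \<open>pos_part X \<inter> P = {}\<close> by blast
      then obtain Y where Y: "?okY Y"
        and Y_min: "\<And>Z. ?okY Z \<Longrightarrow> card (pos_part Y - A) \<le> card (pos_part Z - A)"
        using ex_has_least_nat[of ?okY _ "\<lambda>Y. card (pos_part Y - A)"] by metis
      have "pos_part Y \<subseteq> A"
      proof (rule ccontr)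
        assume "\<not> pos_part Y \<subseteq> A"
        then obtain f where f: "f \<in> pos_part Y" "f \<notin> A" by blast
        have f_ground: "f \<in> ground M" using f(1) Y circuit_in_ground unfolding supp_def by blast
        then obtain F where F: "F \<in> circuits M" "neg_part F = {f}" "pos_part F \<subseteq> A"
          using A f(2) unfolding gen_def by blast
        have "f \<notin> P" using Y f by blast
        have "Y \<noteq> opposite F"
        proof
          assume "Y = opposite F"
          then have "F = SSet {a} {f}" using Y F by (intro signed_set_eqI) auto
          then show False using F(1) \<open>f \<notin> P\<close> f_ground by (simp add: P_def)
        qed
        moreover have "f \<in> sep Y F" using f F by (auto simp: sep_def)
        ultimately obtain Z where Z: "Z \<in> circuits M" "eliminates Z Y F f"
          using elimination Y F by blast
        have "neg_part Z \<subseteq> {a}" and pos: "pos_part Z - A \<subseteq> (pos_part Y - A) - {f}"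
          using Z(2) Y F by (auto simp: eliminates_def)
        then have "neg_part Z = {a}" using signs(2)[OF Z(1)] by blast
        moreover have "(pos_part Z - A) \<inter> P = {}" using Y pos by blast
        ultimately have "?okY Z" using Z(1) by blast
        moreover have "finite (pos_part Y - A)"
          using finite_supp[of Y] Y by (simp add: supp_def)
        then have "card (pos_part Z - A) < card (pos_part Y - A)"
          using pos f by (intro psubset_card_mono) auto
        ultimately show False using Y_min[of Z] by simp
      qed
      then show ?thesis using Y circuit_disjoint[of Y] by blast
    qed
    then obtain X where X: "X \<in> circuits M" "neg_part X = {a}" "pos_part X \<subseteq> A - {a}" by blast
    \<comment> \<open>\<open>a\<close> is generated by \<open>A - {a}\<close>, so it can be
      eliminated from every other generating circuit, against the minimality of
      \<open>A\<close>.\<close>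
    have "gen (A - {a}) f" if "f \<in> ground M" for f
    proof (cases "f \<in> A")
      case True
      then show ?thesis using X by (auto simp: gen_def)
    next
      case False
      moreover have "gen A f" using A that by blast
      ultimately obtain Y where Y: "Y \<in> circuits M" "neg_part Y = {f}" "pos_part Y \<subseteq> A"
        unfolding gen_def by blast
      show ?thesis
      proof (cases "a \<in> pos_part Y")
        case True
        have "Y \<noteq> opposite X" using X(3) Y(2) False by auto
        moreover have "a \<in> sep Y X" using True X(2) by (auto simp: sep_def)
        ultimately obtain Z where Z: "Z \<in> circuits M" "eliminates Z Y X a"
          using elimination Y(1) X(1) by blast
        have "neg_part Z \<subseteq> {f}" "pos_part Z \<subseteq> A - {a}"
          using Z(2) X Y by (auto simp: eliminates_def)
        then show ?thesis using Z(1) signs(2)[OF Z(1)] unfolding gen_def by blast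
      qed (use Y in \<open>auto simp: gen_def\<close>)
    qed
    then have "?ok (A - {a})" using A ae by blast
    then have "card A \<le> card (A - {a})" by (rule A_min)
    then show False using a fin_A by (meson card_Diff1_less not_le)
  qed
  then have "A = {e}" using A by blast
  then obtain X where X: "X \<in> circuits M" "neg_part X = {f}" "pos_part X \<subseteq> {e}"
    using A f unfolding gen_def by blast
  then have "X = SSet {e} {f}"
    using signs(1)[OF X(1)] by (intro signed_set_eqI) auto
  then show ?thesis using X by simp
qed

text \<open>Contracting everything outside a smallest covector through \<open>e\<close> makes it the
  ground set, to which \<open>parallel_if_minimal_pos_covector\<close> applies; the two-element
  circuits found there lift to circuits of \<open>M\<close>.\<close>

lemma minimal_pos_covector:
  assumes "pos_covector M D" "e \<in> D"
  obtains D' where "pos_covector M D'" "e \<in> D'" "D' \<subseteq> D"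
    "\<And>f. f \<in> D' \<Longrightarrow> f \<noteq> e \<Longrightarrow> \<exists>X \<in> circuits M. supp X \<inter> D' = {e, f}"
proof -
  let ?ok = "\<lambda>D'. pos_covector M D' \<and> e \<in> D' \<and> D' \<subseteq> D"
  obtain D' where D': "?ok D'" and min: "\<And>D''. ?ok D'' \<Longrightarrow> card D' \<le> card D''"
    using ex_has_least_nat[of ?ok D card] assms by blast
  define N where "N = minor M (ground M) (ground M - D')"
  interpret N: oriented_matroid N unfolding N_def by (rule oriented_matroid_minor)
  have ground: "ground N = D'"
    using D' unfolding N_def minor_ground pos_covector_def by blast
  have covector: "pos_covector N D'' \<longleftrightarrow> pos_covector M D''" if "D'' \<subseteq> D'" for D''
  proof -
    have "D'' \<subseteq> ground M \<inter> ground M - (ground M - D')" "D'' \<subseteq> ground M"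
      using that D' unfolding pos_covector_def by blast+
    then show ?thesis
      using circuit_in_ground unfolding N_def pos_covector_minor by (simp add: pos_covector_def)
  qed
  have parallel: "SSet {e} {f} \<in> circuits N" if "f \<in> D'" "f \<noteq> e" for f
  proof (rule N.parallel_if_minimal_pos_covector)
    fix D'' assume *: "e \<in> D''" "D'' \<subset> ground N"
    show "\<not> pos_covector N D''"
    proof
      assume "pos_covector N D''"
      then have "card D' \<le> card D''"
        using covector * D' ground by (intro min) blast
      moreover have "finite D'"
        using N.finite_ground ground by simp
      ultimately show False using * ground psubset_card_mono[of D' D''] by simp
    qed
  qed (use ground covector D' that in auto)
  have "\<exists>X \<in> circuits M. supp X \<inter> D' = {e, f}" if f: "f \<in> D'" "f \<noteq> e" for f
  proof -
    obtain Y where Y: "Y \<in> circuits M" "SSet {e} {f} = remove_elts Y (ground M - D')"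
      using parallel[OF f] unfolding N_def by (auto elim: minor_circuitE)
    have "supp Y \<inter> D' = supp Y - (ground M - D')"
      using circuit_in_ground[OF Y(1)] by blast
    also have "\<dots> = supp (SSet {e} {f})" unfolding Y(2) by simp
    also have "\<dots> = {e, f}" by (auto simp: supp_def)
    finally show ?thesis using Y(1) by blast
  qed
  then show thesis using that D' by blast
qed


subsection \<open>Positive cocircuits\<close>

lemma mat_indep_iff: "mat_indep M I \<longleftrightarrow> I \<subseteq> ground M \<and> (\<forall>X \<in> circuits M. \<not> supp X \<subseteq> I)"
  by (auto simp: mat_indep_def mat_circuits_def)

lemma maximal_indep_subset:
  assumes "A \<subseteq> ground M"
  obtains I where "mat_indep M I" "I \<subseteq> A" "\<forall>J. mat_indep M J \<longrightarrow> J \<subseteq> A \<longrightarrow> I \<subseteq> J \<longrightarrow> J = I"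
proof -
  let ?S = "{I. mat_indep M I \<and> I \<subseteq> A}"
  have "finite ?S"
    by (rule finite_subset[of _ "Pow (ground M)"]) (auto simp: finite_ground mat_indep_iff)
  moreover have "{} \<in> ?S"
    using circuit_nonempty by (auto simp: mat_indep_iff)
  ultimately obtain I where I: "I \<in> ?S" "\<forall>J \<in> ?S. I \<subseteq> J \<longrightarrow> I = J"
    using finite_has_maximal2[of ?S "{}"] by auto
  show thesis
    by (rule that[of I]) (use I in auto)
qed

lemma mat_coindep_empty: "mat_coindep M {}"
proof -
  obtain B where "mat_indep M B" "B \<subseteq> ground M"
      "\<forall>J. mat_indep M J \<longrightarrow> J \<subseteq> ground M \<longrightarrow> B \<subseteq> J \<longrightarrow> J = B"
    using maximal_indep_subset[OF subset_refl] by blast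
  then have "mat_basis M B" unfolding mat_basis_def by (metis mat_indep_iff psubset_eq)
  then show ?thesis unfolding mat_coindep_def by blast
qed

text \<open>Each element of \<open>X\<close> in \<open>A - I\<close> closes a circuit with
  \<open>I\<close> and can be eliminated against it; \<open>j\<close>, being outside
  \<open>A\<close>, survives.\<close>

lemma circuit_in_maximal_indep:
  assumes I: "mat_indep M I" "I \<subseteq> A" "A \<subseteq> ground M"
    and max: "\<forall>J. mat_indep M J \<longrightarrow> J \<subseteq> A \<longrightarrow> I \<subseteq> J \<longrightarrow> J = I"
    and X: "X \<in> circuits M" "j \<in> supp X" "supp X \<subseteq> insert j A" and j: "j \<notin> A"
  shows "\<exists>Y \<in> circuits M. supp Y \<subseteq> insert j I"
  using X
proof (induction "card (supp X - insert j I)" arbitrary: X rule: less_induct)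
  case less
  show ?case
  proof (cases "supp X \<subseteq> insert j I")
    case True
    then show ?thesis using less.prems by blast
  next
    case False
    then obtain z where z: "z \<in> supp X" "z \<noteq> j" "z \<notin> I" by blast
    then have zA: "z \<in> A" using less.prems by blast
    have "\<not> mat_indep M (insert z I)" using max z zA I(2) by blast
    then obtain Y where Y: "Y \<in> circuits M" "supp Y \<subseteq> insert z I"
      using I zA unfolding mat_indep_iff by blast
    have zY: "z \<in> supp Y" using Y I(1) unfolding mat_indep_iff by blast
    have jY: "j \<notin> supp Y" using Y(2) I(2) j z(2) by blast
    obtain Z where Z: "Z \<in> circuits M" "supp Z \<subseteq> supp X \<union> supp Y - {z}" "j \<in> supp Z"
      using circuit_strong_elimination[OF less.prems(1) Y(1) z(1) zY less.prems(2) jY] by blast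
    note sub = Z(2)
    have "supp Z - insert j I \<subseteq> supp X - insert j I - {z}" using sub Y(2) by blast
    moreover have "finite (supp X - insert j I)" using finite_supp[OF less.prems(1)] by blast
    ultimately have "card (supp Z - insert j I) < card (supp X - insert j I)"
      using z by (intro psubset_card_mono) auto
    moreover have "supp Z \<subseteq> insert j A" using sub less.prems(3) Y(2) zA I(2) by blast
    ultimately show ?thesis using less.hyps Z by blast
  qed
qed

text \<open>By \<open>single\<close>, no basis avoids \<open>D\<close>: adding an element of
  \<open>D\<close> to it would create a circuit meeting \<open>D\<close> once. By
  \<open>pair\<close>, a maximal independent subset of the complement of \<open>D\<close> together
  with one \<open>f\<close> in \<open>D\<close> spans the rest of \<open>D\<close>, hence is a
  basis, and its complement contains every subset of \<open>D\<close> without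
  \<open>f\<close>.\<close>

lemma mat_cocircuitI:
  assumes D: "D \<subseteq> ground M" "D \<noteq> {}"
    and single: "\<And>X x. X \<in> circuits M \<Longrightarrow> supp X \<inter> D \<noteq> {x}"
    and pair: "\<And>e f. e \<in> D \<Longrightarrow> f \<in> D \<Longrightarrow> e \<noteq> f \<Longrightarrow> \<exists>X \<in> circuits M. supp X \<inter> D = {e, f}"
  shows "D \<in> mat_cocircuits M"
  unfolding mat_cocircuits_def
proof (intro CollectI conjI allI impI)
  show "D \<subseteq> ground M" by fact
  show "\<not> mat_coindep M D"
  proof
    assume "mat_coindep M D"
    then obtain B where B: "mat_basis M B" "D \<inter> B = {}" by (auto simp: mat_coindep_def)
    obtain e where e: "e \<in> D" using D by blast
    then have "B \<subset> insert e B" using B(2) by blast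
    then have "\<not> mat_indep M (insert e B)" using B(1) unfolding mat_basis_def by blast
    then obtain X where X: "X \<in> circuits M" "supp X \<subseteq> insert e B"
      using B(1) e D(1) unfolding mat_basis_def mat_indep_iff by blast
    then have "\<not> supp X \<subseteq> B" using B(1) unfolding mat_basis_def mat_indep_iff by blast
    then have "supp X \<inter> D = {e}" using X(2) B(2) e by blast
    then show False using single X(1) by blast
  qed
  fix D' assume "D' \<subset> D"
  then obtain f where f: "f \<in> D" "f \<notin> D'" by blast
  define A where "A = insert f (ground M - D)"
  have A: "A \<subseteq> ground M" using f D by (auto simp: A_def)
  obtain I where I: "mat_indep M I" "I \<subseteq> A"
      and max: "\<forall>J. mat_indep M J \<longrightarrow> J \<subseteq> A \<longrightarrow> I \<subseteq> J \<longrightarrow> J = I"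
    using maximal_indep_subset[OF A] by blast
  have "\<not> mat_indep M J" if "I \<subset> J" for J
  proof
    assume J: "mat_indep M J"
    then have "\<not> J \<subseteq> A" using max that by blast
    then obtain j where j: "j \<in> J" "j \<notin> A" by blast
    moreover have "j \<in> ground M" using j J by (auto simp: mat_indep_iff)
    ultimately have jD: "j \<in> D" "j \<noteq> f" by (auto simp: A_def)
    then obtain X where X: "X \<in> circuits M" "supp X \<inter> D = {j, f}" using pair f by blast
    then have "supp X \<subseteq> insert j A" "j \<in> supp X"
      using circuit_in_ground[OF X(1)] by (auto simp: A_def)
    then obtain Y where "Y \<in> circuits M" "supp Y \<subseteq> insert j I"
      using circuit_in_maximal_indep[OF I A max X(1)] j(2) by blast
    then show False using J j(1) that unfolding mat_indep_iff by blast
  qed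
  then have "mat_basis M I" using I(1) unfolding mat_basis_def by blast
  moreover have "D' \<subseteq> ground M - I"
    using \<open>D' \<subset> D\<close> f(2) D(1) I(2) by (auto simp: A_def)
  ultimately show "mat_coindep M D'" unfolding mat_coindep_def by blast
qed

lemma pos_cocircuit_pos_covector:
  assumes "D \<in> pos_cocircuits M"
  shows "pos_covector M D" "D \<noteq> {}"
proof -
  obtain Y where Y: "Y \<in> cocircuits M" "neg_part Y = {}" "D = supp Y"
    using assms by (auto simp: pos_cocircuits_def)
  then have cocircuit: "D \<in> mat_cocircuits M" and pos: "pos_part Y = D"
    by (auto simp: cocircuits_def supp_def)
  show "D \<noteq> {}" using cocircuit mat_coindep_empty by (auto simp: mat_cocircuits_def)
  show "pos_covector M D"
  proof (rule pos_covectorI)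
    show "D \<subseteq> ground M" using cocircuit by (auto simp: mat_cocircuits_def)
    fix X x assume X: "X \<in> circuits M" "x \<in> pos_part X" "x \<in> D"
    then have "orthogonal X Y" using Y(1) by (auto simp: cocircuits_def)
    then show "neg_part X \<inter> D \<noteq> {}"
      using X(2,3) pos Y(2) by (auto simp: orthogonal_def supp_def)
  qed
qed

text \<open>A minimal covector through \<open>e\<close> satisfies \<open>mat_cocircuitI\<close>:
  from circuits for the pairs \<open>{e, g}\<close> and \<open>{e, f}\<close>, eliminating
  \<open>e\<close> gives one for \<open>{g, f}\<close>. The circuits through \<open>e\<close> stay
  in the conclusion for the connectivity of bounded minors.\<close>

lemma pos_covector_pos_cocircuit:
  assumes "pos_covector M D" "e \<in> D"
  shows "\<exists>D' \<in> pos_cocircuits M. e \<in> D' \<and> D' \<subseteq> D \<and>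
    (\<forall>f \<in> D'. f \<noteq> e \<longrightarrow> (\<exists>X \<in> circuits M. supp X \<inter> D' = {e, f}))"
proof -
  obtain D' where D': "pos_covector M D'" "e \<in> D'" "D' \<subseteq> D"
    and par: "\<And>f. f \<in> D' \<Longrightarrow> f \<noteq> e \<Longrightarrow> \<exists>X \<in> circuits M. supp X \<inter> D' = {e, f}"
    using minimal_pos_covector[OF assms] by blast
  have "D' \<in> mat_cocircuits M"
  proof (rule mat_cocircuitI)
    show "D' \<subseteq> ground M" using D'(1) by (simp add: pos_covector_def)
    show "D' \<noteq> {}" using D'(2) by blast
    show "supp X \<inter> D' \<noteq> {x}" if "X \<in> circuits M" for X x
      using pos_covector_not_single D'(1) that by blast
    fix g f assume gf: "g \<in> D'" "f \<in> D'" "g \<noteq> f"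
    show "\<exists>X \<in> circuits M. supp X \<inter> D' = {g, f}"
    proof (cases "g = e \<or> f = e")
      case True
      then show ?thesis using par gf by (metis insert_commute)
    next
      case False
      then obtain X Y where X: "X \<in> circuits M" "supp X \<inter> D' = {e, g}"
        and Y: "Y \<in> circuits M" "supp Y \<inter> D' = {e, f}"
        using par gf by metis
      have e: "e \<in> supp X" "e \<in> supp Y" using X Y by auto
      have g: "g \<in> supp X" "g \<notin> supp Y" using X(2) Y(2) gf False by auto
      obtain Z where Z: "Z \<in> circuits M" "supp Z \<subseteq> supp X \<union> supp Y - {e}" "g \<in> supp Z"
        using circuit_strong_elimination[OF X(1) Y(1) e g] by blast
      have "supp Z \<inter> D' \<subseteq> (supp X \<inter> D') \<union> (supp Y \<inter> D') - {e}"
        using Z(2) by auto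
      then have "supp Z \<inter> D' \<subseteq> {g, f}" unfolding X(2) Y(2) by blast
      moreover have "supp Z \<inter> D' \<noteq> {g}" using pos_covector_not_single D'(1) Z(1) by blast
      ultimately have "supp Z \<inter> D' = {g, f}" using Z(3) gf(1) by blast
      then show ?thesis using Z(1) by blast
    qed
  qed
  moreover have "orthogonal X (SSet D' {})" if "X \<in> circuits M" for X
    using pos_covector_both_signs[OF D'(1) that] by (auto simp: orthogonal_def supp_def)
  ultimately have "SSet D' {} \<in> cocircuits M" by (simp add: cocircuits_def supp_def)
  then have "D' \<in> pos_cocircuits M"
    unfolding pos_cocircuits_def by (force simp: supp_def)
  then show ?thesis using D' par by blast
qed

lemma pos_covector_covered:
  assumes "pos_covector M D" "e \<in> D"
  shows "\<exists>D' \<in> pos_cocircuits M. e \<in> D' \<and> D' \<subseteq> D"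
  using pos_covector_pos_cocircuit[OF assms] by blast

text \<open>An element in no positive circuit lies in the covector complementary to their union,
  hence in a positive cocircuit.\<close>

lemma totally_cyclic_iff: "totally_cyclic M \<longleftrightarrow> (\<forall>x \<in> ground M. \<exists>C \<in> pos_circuits M. x \<in> C)"
proof
  assume "totally_cyclic M"
  then have "x \<notin> ground M - \<Union>(pos_circuits M)" for x
    using pos_covector_covered[OF pos_covector_compl_pos_circuits, of x]
    by (auto simp: totally_cyclic_def)
  then show "\<forall>x \<in> ground M. \<exists>C \<in> pos_circuits M. x \<in> C"
    by blast
next
  assume *: "\<forall>x \<in> ground M. \<exists>C \<in> pos_circuits M. x \<in> C"
  have "D \<notin> pos_cocircuits M" for D
  proof
    assume "D \<in> pos_cocircuits M"
    then have D: "pos_covector M D" "D \<noteq> {}" by (rule pos_cocircuit_pos_covector)+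
    then obtain x where "x \<in> D" "x \<in> ground M" by (auto simp: pos_covector_def)
    then show False using * pos_circuit_disjoint_pos_covector[OF _ D(1)] by blast
  qed
  then show "totally_cyclic M" by (auto simp: totally_cyclic_def)
qed


subsection \<open>Connectivity\<close>

text \<open>Eliminating a common element \<open>g\<close> in two ways gives \<open>Z\<close> through
  \<open>x\<close> and \<open>W\<close> through \<open>y\<close>, and \<open>W\<close> has an
  element \<open>w\<close> in \<open>X\<close> outside \<open>Y\<close>. If \<open>w\<close> is in
  \<open>Z\<close>, the pair \<open>Z\<close>, \<open>W\<close> has a union without
  \<open>g\<close>; otherwise the pair \<open>Z\<close>, \<open>Y\<close> has a union without
  \<open>w\<close>. Either union is smaller.\<close>

lemma common_circuit_trans:
  assumes "X \<in> circuits M" "Y \<in> circuits M" "x \<in> supp X" "y \<in> supp Y" "supp X \<inter> supp Y \<noteq> {}"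
  shows "\<exists>Z \<in> circuits M. x \<in> supp Z \<and> y \<in> supp Z"
  using assms
proof (induction "card (supp X \<union> supp Y)" arbitrary: X Y rule: less_induct)
  case less
  note X = less.prems(1) and Y = less.prems(2) and x = less.prems(3) and y = less.prems(4)
  have fin: "finite (supp X \<union> supp Y)" using X Y finite_supp by blast
  show ?case
  proof (cases "x \<in> supp Y \<or> y \<in> supp X")
    case True
    then show ?thesis using X Y x y by blast
  next
    case False
    obtain g where g: "g \<in> supp X" "g \<in> supp Y" using less.prems(5) by blast
    obtain Z where Z: "Z \<in> circuits M" "supp Z \<subseteq> supp X \<union> supp Y - {g}" "x \<in> supp Z"
      using circuit_strong_elimination[OF X Y g x] False by blast
    obtain W where W: "W \<in> circuits M" "supp W \<subseteq> supp Y \<union> supp X - {g}" "y \<in> supp W"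
      using circuit_strong_elimination[OF Y X g(2,1) y] False by blast
    have ZY: "supp Z \<inter> supp Y \<noteq> {}" using circuit_not_psubset[OF Z(1) X] Z(2) g by blast
    obtain w where w: "w \<in> supp W" "w \<in> supp X" "w \<notin> supp Y"
      using circuit_not_psubset[OF W(1) Y] W(2) g by blast
    show ?thesis
    proof (cases "w \<in> supp Z")
      case True
      have "card (supp Z \<union> supp W) < card (supp X \<union> supp Y)"
        using Z(2) W(2) g fin by (intro psubset_card_mono) auto
      then show ?thesis using less.hyps[OF _ Z(1) W(1) Z(3) W(3)] True w by blast
    next
      case False
      have "supp Z \<union> supp Y \<subset> supp X \<union> supp Y"
        using Z(2) False w by blast
      then have "card (supp Z \<union> supp Y) < card (supp X \<union> supp Y)"
        using fin by (rule psubset_card_mono[rotated])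
      then show ?thesis using less.hyps[OF _ Z(1) Y Z(3) y ZY] by blast
    qed
  qed
qed

lemma mat_connected_if_common_circuit:
  assumes "\<And>x. x \<in> ground M \<Longrightarrow> x \<noteq> p \<Longrightarrow> \<exists>X \<in> circuits M. x \<in> supp X \<and> p \<in> supp X"
  shows "mat_connected M"
  unfolding mat_connected_def
proof (intro ballI impI)
  fix e f assume ef: "e \<in> ground M" "f \<in> ground M" "e \<noteq> f"
  have "\<exists>Z \<in> circuits M. e \<in> supp Z \<and> f \<in> supp Z"
  proof (cases "e = p \<or> f = p")
    case True
    then show ?thesis using assms[OF ef(1)] assms[OF ef(2)] ef(3) by blast
  next
    case False
    obtain X where X: "X \<in> circuits M" "e \<in> supp X" "p \<in> supp X"
      using assms[OF ef(1)] False by blast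
    obtain Y where Y: "Y \<in> circuits M" "f \<in> supp Y" "p \<in> supp Y"
      using assms[OF ef(2)] False by blast
    show ?thesis using common_circuit_trans[OF X(1) Y(1) X(2) Y(2)] X(3) Y(3) by blast
  qed
  then show "\<exists>C \<in> mat_circuits M. e \<in> C \<and> f \<in> C" by (auto simp: mat_circuits_def)
qed

text \<open>A positive cocircuit through \<open>x\<close> also contains \<open>p\<close>, and some
  circuit meets it exactly in these two elements. A loop would meet the covector
  \<open>ground M\<close> in a single element.\<close>

lemma bounded_connected:
  assumes "bounded_wrt M p"
  shows "mat_connected M" "\<not> is_a_loop M"
proof -
  have acyc: "pos_covector M (ground M)" and p: "\<And>D. D \<in> pos_cocircuits M \<Longrightarrow> p \<in> D"
    using assms om_acyclic_iff by (auto simp: bounded_wrt_def)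
  show "mat_connected M"
  proof (rule mat_connected_if_common_circuit)
    fix x assume x: "x \<in> ground M" "x \<noteq> p"
    obtain D where D: "D \<in> pos_cocircuits M"
        "\<forall>f \<in> D. f \<noteq> x \<longrightarrow> (\<exists>X \<in> circuits M. supp X \<inter> D = {x, f})"
      using pos_covector_pos_cocircuit[OF acyc x(1)] by blast
    moreover have "p \<in> D" using p D(1) .
    ultimately obtain X where "X \<in> circuits M" "supp X \<inter> D = {x, p}" using x(2) by auto
    then show "\<exists>X \<in> circuits M. x \<in> supp X \<and> p \<in> supp X" by blast
  qed
  show "\<not> is_a_loop M"
  proof
    assume "is_a_loop M"
    then obtain e X where "ground M = {e}" "X \<in> circuits M" "supp X = {e}"
      by (auto simp: is_a_loop_def mat_circuits_def)
    then show False using pos_covector_not_single[OF acyc] by blast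
  qed
qed

lemma dual_bounded_connected:
  assumes "dual_bounded_wrt M p"
  shows "mat_connected M" "\<not> is_an_isthmus M"
proof -
  have cyc: "\<And>x. x \<in> ground M \<Longrightarrow> \<exists>C \<in> pos_circuits M. x \<in> C"
    and p: "\<And>C. C \<in> pos_circuits M \<Longrightarrow> p \<in> C"
    using assms totally_cyclic_iff by (auto simp: dual_bounded_wrt_def)
  show "mat_connected M"
  proof (rule mat_connected_if_common_circuit)
    fix x assume "x \<in> ground M"
    then obtain C where C: "C \<in> pos_circuits M" "x \<in> C" using cyc by blast
    moreover have "p \<in> C" using p C(1) .
    ultimately show "\<exists>X \<in> circuits M. x \<in> supp X \<and> p \<in> supp X"
      by (auto simp: pos_circuits_def)
  qed
  show "\<not> is_an_isthmus M"
  proof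
    assume "is_an_isthmus M"
    then obtain e where e: "ground M = {e}" "\<not> mat_coindep M {e}"
      by (auto simp: is_an_isthmus_def mat_cocircuits_def)
    then obtain X where X: "X \<in> circuits M" "e \<in> supp X"
      using cyc[of e] by (auto simp: pos_circuits_def)
    \<comment> \<open>The only element is a loop, so the empty set is a basis and \<open>{e}\<close>
      is coindependent.\<close>
    then have "supp X = {e}" using circuit_in_ground e(1) by blast
    then have "I = {}" if "mat_indep M I" for I
      using that X(1) e(1) unfolding mat_indep_iff by (metis subset_refl subset_singletonD)
    moreover obtain B where "mat_basis M B"
      using mat_coindep_empty by (auto simp: mat_coindep_def)
    ultimately have "mat_basis M {}" by (auto simp: mat_basis_def)
    then show False using e by (auto simp: mat_coindep_def)
  qed
qed

end

section \<open>Minors of a filtration\<close>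

context oriented_matroid
begin

lemma pos_vector_iff: "pos_vector M B \<longleftrightarrow> B = \<Union>{C \<in> pos_circuits M. C \<subseteq> B}"
  unfolding pos_vector_def by blast

lemma pos_covector_iff:
  "pos_covector M D \<longleftrightarrow> D = \<Union>{D' \<in> pos_cocircuits M. D' \<subseteq> D}"
proof
  assume D: "pos_covector M D"
  show "D = \<Union>{D' \<in> pos_cocircuits M. D' \<subseteq> D}"
    using pos_covector_covered[OF D] by blast
next
  assume "D = \<Union>{D' \<in> pos_cocircuits M. D' \<subseteq> D}"
  moreover have "pos_covector M (\<Union>{D' \<in> pos_cocircuits M. D' \<subseteq> D})"
    using pos_cocircuit_pos_covector(1) by (intro pos_covector_Union) blast
  ultimately show "pos_covector M D" by simp
qed

lemma pos_circuit_ground: "C \<in> pos_circuits M \<Longrightarrow> C \<subseteq> ground M \<and> C \<noteq> {}"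
  using circuit_in_ground circuit_nonempty by (auto simp: pos_circuits_def)

text \<open>The complement of the union of the positive circuits is a covector, hence covered by
  positive cocircuits, and these are disjoint from all positive circuits.\<close>

lemma compl_Union_pos_cocircuits: "ground M - \<Union>(pos_cocircuits M) = \<Union>(pos_circuits M)"
proof -
  let ?D = "ground M - \<Union>(pos_circuits M)"
  have "?D \<subseteq> \<Union>(pos_cocircuits M)"
    using pos_covector_covered[OF pos_covector_compl_pos_circuits] by blast
  moreover have "C \<inter> D = {}" if "C \<in> pos_circuits M" "D \<in> pos_cocircuits M" for C D
    using that pos_circuit_disjoint_pos_covector pos_cocircuit_pos_covector by blast
  ultimately show ?thesis using pos_circuit_ground by blast
qed

section \<open>Bounded minors and positive covectors\<close>

text \<open>A circuit inside \<open>A\<close> is handled by the minor; any other meets the covector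
  \<open>ground M - A\<close> and so has a negative element there.\<close>

lemma pos_covector_minor_extend:
  assumes "B \<subseteq> A" "A \<subseteq> ground M" and A: "pos_covector M (ground M - A)"
    and D: "pos_covector (minor M A B) D"
  shows "pos_covector M (D \<union> (ground M - A))"
proof (rule pos_covectorI)
  show "D \<union> (ground M - A) \<subseteq> ground M" using D by (auto simp: pos_covector_minor)
  fix X x assume X: "X \<in> circuits M" "x \<in> pos_part X" "x \<in> D \<union> (ground M - A)"
  show "neg_part X \<inter> (D \<union> (ground M - A)) \<noteq> {}"
  proof (cases "supp X \<subseteq> A")
    case True
    then have "x \<in> D" using X by (auto simp: supp_def)
    then have "neg_part X \<inter> D \<noteq> {}"
      using D X(1,2) True unfolding pos_covector_minor by blast
    then show ?thesis by blast
  next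
    case False
    then obtain y where "y \<in> supp X" "y \<in> ground M - A" using circuit_in_ground X(1) by blast
    then show ?thesis using pos_covector_both_signs(2)[OF A X(1)] by blast
  qed
qed

lemma pos_covector_minor_restrict:
  assumes "D \<subseteq> ground M - B" "pos_covector M D"
  shows "pos_covector (minor M A B) (D \<inter> A)"
  unfolding pos_covector_minor
proof (intro conjI ballI impI)
  show "D \<inter> A \<subseteq> ground M \<inter> A - B" using assms by blast
  fix X assume X: "X \<in> circuits M" "supp X \<subseteq> A" "pos_part X \<inter> (D \<inter> A) \<noteq> {}"
  then have "neg_part X \<inter> D \<noteq> {}" using assms unfolding pos_covector_def by blast
  then show "neg_part X \<inter> (D \<inter> A) \<noteq> {}" using X(2) by (auto simp: supp_def)
qed

lemma pos_cocircuits_contain_iff: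
  "(\<forall>D \<in> pos_cocircuits M. p \<in> D) \<longleftrightarrow> (\<forall>D. pos_covector M D \<and> D \<noteq> {} \<longrightarrow> p \<in> D)"
proof (intro iffI allI impI ballI)
  fix D assume "\<forall>D \<in> pos_cocircuits M. p \<in> D" "pos_covector M D \<and> D \<noteq> {}"
  then show "p \<in> D" using pos_covector_covered[of D] by blast
qed (use pos_cocircuit_pos_covector in blast)

text \<open>Extension by \<open>ground M - A\<close> and restriction to \<open>A\<close> link the
  covectors of the minor with those of \<open>M\<close> inside \<open>ground M - B\<close>.
  Boundedness becomes a condition on \<open>M\<close> alone, and the covector property passes from
  the complement of \<open>A\<close> to that of \<open>B\<close>.\<close>

lemma bounded_minor_iff:
  assumes "B \<subseteq> A" "A \<subseteq> ground M" "p \<in> A - B" and A: "pos_covector M (ground M - A)"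
  shows "bounded_wrt (minor M A B) p \<longleftrightarrow> pos_covector M (ground M - B) \<and>
    (\<forall>D \<in> pos_cocircuits M. D \<subseteq> ground M - B \<and> \<not> D \<subseteq> ground M - A \<longrightarrow> p \<in> D)"
proof -
  let ?N = "minor M A B"
  interpret N: oriented_matroid ?N by (rule oriented_matroid_minor)
  have ground: "ground ?N = A - B" using assms by (auto simp: minor_ground)
  have acyclic: "om_acyclic ?N \<longleftrightarrow> pos_covector M (ground M - B)"
    unfolding N.om_acyclic_iff ground
  proof
    assume "pos_covector ?N (A - B)"
    then have "pos_covector M ((A - B) \<union> (ground M - A))"
      using pos_covector_minor_extend assms by blast
    moreover have "(A - B) \<union> (ground M - A) = ground M - B" using assms by blast
    ultimately show "pos_covector M (ground M - B)" by simp
  next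
    assume "pos_covector M (ground M - B)"
    then have "pos_covector ?N ((ground M - B) \<inter> A)"
      using pos_covector_minor_restrict by blast
    moreover have "(ground M - B) \<inter> A = A - B" using assms by blast
    ultimately show "pos_covector ?N (A - B)" by simp
  qed
  have "(\<forall>D. pos_covector ?N D \<and> D \<noteq> {} \<longrightarrow> p \<in> D) \<longleftrightarrow>
     (\<forall>D \<in> pos_cocircuits M. D \<subseteq> ground M - B \<and> \<not> D \<subseteq> ground M - A \<longrightarrow> p \<in> D)"
  proof (intro iffI ballI allI impI)
    fix D assume *: "\<forall>D. pos_covector ?N D \<and> D \<noteq> {} \<longrightarrow> p \<in> D"
      and D: "D \<in> pos_cocircuits M" "D \<subseteq> ground M - B \<and> \<not> D \<subseteq> ground M - A"
    have "pos_covector ?N (D \<inter> A)"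
      using pos_covector_minor_restrict pos_cocircuit_pos_covector(1) D by blast
    then show "p \<in> D" using * D by blast
  next
    fix D assume *: "\<forall>D \<in> pos_cocircuits M. D \<subseteq> ground M - B \<and> \<not> D \<subseteq> ground M - A \<longrightarrow> p \<in> D"
      and D: "pos_covector ?N D \<and> D \<noteq> {}"
    then obtain x where x: "x \<in> D" by blast
    have sub: "D \<subseteq> A - B" using D ground by (auto simp: pos_covector_def)
    have "x \<in> D \<union> (ground M - A)" using x by blast
    then obtain D' where D': "D' \<in> pos_cocircuits M" "x \<in> D'" "D' \<subseteq> D \<union> (ground M - A)"
      using pos_covector_covered[OF pos_covector_minor_extend[OF assms(1,2) A conjunct1[OF D]]]
      by blast
    have "D' \<subseteq> ground M - B" "\<not> D' \<subseteq> ground M - A"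
      using D'(2,3) x sub assms(1,2) by blast+
    then have "p \<in> D'" using * D'(1) by blast
    then show "p \<in> D" using D'(3) assms(3) by blast
  qed
  then show ?thesis
    unfolding bounded_wrt_def acyclic N.pos_cocircuits_contain_iff using ground assms(3) by blast
qed

section \<open>Dual-bounded minors and positive vectors\<close>

text \<open>A lift to \<open>M\<close> has negative elements only in \<open>B\<close>, where
  \<open>pos_vector_elimination\<close> removes them.\<close>

lemma minor_pos_circuit_lift:
  assumes "B \<subseteq> A" "A \<subseteq> ground M" and B: "pos_vector M B"
    and C: "C \<in> pos_circuits (minor M A B)" "x \<in> C"
  shows "\<exists>C' \<in> pos_circuits M. x \<in> C' \<and> C' \<subseteq> C \<union> B"
proof -
  obtain X where X: "X \<in> circuits (minor M A B)" "neg_part X = {}" "C = supp X"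
    using C(1) by (auto simp: pos_circuits_def)
  obtain Y where Y: "Y \<in> circuits M" "supp Y \<subseteq> A" "X = remove_elts Y B"
    using X(1) by (rule minor_circuitE)
  have "x \<in> supp Y" "x \<notin> B" "neg_part Y \<subseteq> B" "supp Y \<subseteq> C \<union> B"
    using X Y C(2) by auto
  then show ?thesis
    using pos_vector_elimination[OF B Y(1), of x] by (meson Un_least Un_upper2 subset_trans)
qed

lemma minor_pos_circuit_below:
  assumes "C \<in> pos_circuits M" "C \<subseteq> A" "x \<in> C - B"
  shows "\<exists>C' \<in> pos_circuits (minor M A B). x \<in> C' \<and> C' \<subseteq> C - B"
proof -
  obtain X where X: "X \<in> circuits M" "neg_part X = {}" "C = supp X"
    using assms(1) by (auto simp: pos_circuits_def)
  obtain W where W: "W \<in> circuits (minor M A B)" "x \<in> supp W" "conformal W X"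
    using minor_circuit_conformal[OF X(1)] assms(2,3) X(3) by metis
  have "supp W \<inter> B = {}"
    using W(1) by (auto elim: minor_circuitE)
  then have "neg_part W = {}" "supp W \<subseteq> C - B"
    using W(3) X by (auto simp: conformal_def supp_def)
  then show ?thesis using W(1,2) unfolding pos_circuits_def by blast
qed

text \<open>Here the property passes upwards, from the positive vector \<open>B\<close> to
  \<open>A\<close>: positive circuits of the minor lift up to elements of \<open>B\<close>, and the
  traces of those of \<open>M\<close> are covered by positive circuits of the minor.\<close>

lemma dual_bounded_minor_iff:
  assumes "B \<subseteq> A" "A \<subseteq> ground M" "p \<in> A - B" and B: "pos_vector M B"
  shows "dual_bounded_wrt (minor M A B) p \<longleftrightarrow> pos_vector M A \<and>
    (\<forall>C \<in> pos_circuits M. C \<subseteq> A \<and> \<not> C \<subseteq> B \<longrightarrow> p \<in> C)"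
proof -
  let ?N = "minor M A B"
  interpret N: oriented_matroid ?N by (rule oriented_matroid_minor)
  have ground: "ground ?N = A - B" using assms by (auto simp: minor_ground)
  have cyclic: "totally_cyclic ?N \<longleftrightarrow> pos_vector M A"
    unfolding N.totally_cyclic_iff ground
  proof
    assume *: "\<forall>x \<in> A - B. \<exists>C \<in> pos_circuits ?N. x \<in> C"
    show "pos_vector M A"
      unfolding pos_vector_def
    proof
      fix x assume x: "x \<in> A"
      show "\<exists>C \<in> pos_circuits M. x \<in> C \<and> C \<subseteq> A"
      proof (cases "x \<in> B")
        case True
        then show ?thesis using B assms(1) unfolding pos_vector_def by (meson subset_trans)
      next
        case False
        then obtain C where C: "C \<in> pos_circuits ?N" "x \<in> C" using * x by blast
        then obtain C' where "C' \<in> pos_circuits M" "x \<in> C'" "C' \<subseteq> C \<union> B"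
          using minor_pos_circuit_lift[OF assms(1,2) B] by blast
        moreover have "C \<subseteq> A" using N.pos_circuit_ground[OF C(1)] ground by blast
        ultimately show ?thesis using assms(1) by blast
      qed
    qed
  next
    assume *: "pos_vector M A"
    show "\<forall>x \<in> A - B. \<exists>C \<in> pos_circuits ?N. x \<in> C"
    proof
      fix x assume x: "x \<in> A - B"
      then obtain C where "C \<in> pos_circuits M" "x \<in> C" "C \<subseteq> A" using * unfolding pos_vector_def by blast
      then show "\<exists>C \<in> pos_circuits ?N. x \<in> C" using minor_pos_circuit_below[of C A x B] x by blast
    qed
  qed
  have "(\<forall>C \<in> pos_circuits ?N. p \<in> C) \<longleftrightarrow>
     (\<forall>C \<in> pos_circuits M. C \<subseteq> A \<and> \<not> C \<subseteq> B \<longrightarrow> p \<in> C)"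
  proof (intro iffI ballI impI)
    fix C assume *: "\<forall>C \<in> pos_circuits ?N. p \<in> C"
      and C: "C \<in> pos_circuits M" "C \<subseteq> A \<and> \<not> C \<subseteq> B"
    then obtain x where "x \<in> C - B" by blast
    then show "p \<in> C" using minor_pos_circuit_below[OF C(1)] C(2) * by blast
  next
    fix C assume *: "\<forall>C \<in> pos_circuits M. C \<subseteq> A \<and> \<not> C \<subseteq> B \<longrightarrow> p \<in> C"
      and C: "C \<in> pos_circuits ?N"
    have sub: "C \<subseteq> A - B" "C \<noteq> {}" using N.pos_circuit_ground[OF C] ground by blast+
    then obtain x where x: "x \<in> C" by blast
    then obtain C' where C': "C' \<in> pos_circuits M" "x \<in> C'" "C' \<subseteq> C \<union> B"
      using minor_pos_circuit_lift[OF assms(1,2) B C] by blast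
    have "C' \<subseteq> A" "\<not> C' \<subseteq> B"
      using C'(2,3) x sub(1) assms(1) by blast+
    then have "p \<in> C'" using * C'(1) by blast
    then show "p \<in> C" using C'(3) assms(3) by blast
  qed
  then show ?thesis
    unfolding dual_bounded_wrt_def cyclic using ground assms(3) by blast
qed

end

section \<open>Chains determined by a family of sets\<close>

text \<open>Both halves of a filtration are lists \<open>Gs\<close> of decreasing sets: \<open>Gs ! k\<close> stands for
  \<open>F'\<^sub>k\<close>, with the family of positive circuits, or for \<open>E - F\<^sub>k\<close>, with the family of positive
  cocircuits.\<close>

definition chain_gap :: "'a::linorder set list \<Rightarrow> nat \<Rightarrow> 'a" where
  "chain_gap Gs k = Min (Gs ! (k - 1) - Gs ! k)"

definition decreasing_chain :: "'a::linorder set list \<Rightarrow> bool" where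
  "decreasing_chain Gs \<longleftrightarrow> Gs \<noteq> [] \<and> last Gs = {} \<and>
     (\<forall>k \<in> {1..<length Gs}. Gs ! k \<subset> Gs ! (k - 1)) \<and>
     strict_mono_on {1..<length Gs} (chain_gap Gs)"

text \<open>The first conjunct says that the larger set is a positive vector or covector
  (\<open>pos_vector_iff\<close>, \<open>pos_covector_iff\<close>); the last set of a chain is
  empty, hence trivially one.\<close>

definition chain_step :: "'a::linorder set set \<Rightarrow> 'a set list \<Rightarrow> nat \<Rightarrow> bool" where
  "chain_step \<K> Gs k \<longleftrightarrow> Gs ! (k - 1) = \<Union>{C \<in> \<K>. C \<subseteq> Gs ! (k - 1)} \<and>
     (\<forall>C \<in> \<K>. C \<subseteq> Gs ! (k - 1) \<and> \<not> C \<subseteq> Gs ! k \<longrightarrow> chain_gap Gs k \<in> C)"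

definition adapted_chain :: "'a::linorder set set \<Rightarrow> 'a set list \<Rightarrow> bool" where
  "adapted_chain \<K> Gs \<longleftrightarrow>
     decreasing_chain Gs \<and> Gs ! 0 = \<Union>\<K> \<and> (\<forall>k \<in> {1..<length Gs}. chain_step \<K> Gs k)"

definition active_chain :: "'a::linorder set set \<Rightarrow> 'a set list" where
  "active_chain \<K> = (let a = sorted_list_of_set (Min ` \<K>) in
     map (\<lambda>k. if k < length a then \<Union>{C \<in> \<K>. a ! k \<le> Min C} else {}) [0..<length a + 1])"

text \<open>A member of \<open>\<K>\<close> inside entry \<open>k\<close> but not inside the next
  one has minimum exactly \<open>a ! k\<close>, and this value is also the gap.\<close>

lemma active_chain_adapted:
  fixes \<K> :: "'a::linorder set set"
  assumes fin: "finite (\<Union>\<K>)" and ne: "{} \<notin> \<K>"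
  shows "adapted_chain \<K> (active_chain \<K>)"
proof -
  define a where "a = sorted_list_of_set (Min ` \<K>)"
  define n where "n = length a"
  define G where "G k = (if k < n then \<Union>{C \<in> \<K>. a ! k \<le> Min C} else {})" for k
  have Gs: "active_chain \<K> = map G [0..<n + 1]"
    by (simp add: active_chain_def a_def n_def G_def Let_def)
  have fin_K: "finite \<K>" using fin by (rule finite_UnionD)
  have fin_C: "finite C" "C \<noteq> {}" if "C \<in> \<K>" for C
    using that ne by (auto intro: finite_subset[OF Union_upper fin])
  have set_a: "set a = Min ` \<K>" using fin_K by (simp add: a_def)
  have mono: "a ! i < a ! j" if "i < j" "j < n" for i j
    using sorted_list_of_set.strict_sorted_key_list_of_set[of "Min ` \<K>"] that
    unfolding a_def[symmetric] n_def by (simp add: sorted_wrt_iff_nth_less)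
  have nth: "Gs ! k = G k" if "Gs = map G [0..<n + 1]" "k \<le> n" for Gs k
    using that by (simp del: upt_Suc)
  have index: "\<exists>i < n. Min C = a ! i" if "C \<in> \<K>" for C
    using that set_a by (metis imageI in_set_conv_nth n_def)
  have elts: "a ! k \<le> x" if "x \<in> G k" "k < n" for x k
    using that fin_C by (auto simp: G_def dest: Min_le intro: order_trans)
  have witness: "\<exists>C \<in> \<K>. Min C = a ! k" if "k < n" for k
    using that set_a by (metis (no_types, lifting) imageE n_def nth_mem)
  \<comment> \<open>\<open>a ! k\<close> is the minimum of some member, while all elements of the
    next entry are at least \<open>a ! Suc k\<close>, or that entry is empty.\<close>
  have mem: "a ! k \<in> G k - G (Suc k)" if k: "k < n" for k
  proof -
    obtain C where C: "C \<in> \<K>" "Min C = a ! k" using witness[OF k] by blast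
    then have "a ! k \<in> C" using fin_C[OF C(1)] by (metis Min_in)
    then have "a ! k \<in> G k" using C k by (auto simp: G_def)
    moreover have "a ! k \<notin> G (Suc k)"
    proof (cases "Suc k < n")
      case True
      then show ?thesis using elts[of "a ! k" "Suc k"] mono[of k "Suc k"] by auto
    qed (simp add: G_def)
    ultimately show ?thesis by blast
  qed
  have sub: "G (Suc k) \<subseteq> G k" if "k < n" for k
  proof (cases "Suc k < n")
    case True
    then show ?thesis using mono[of k "Suc k"] by (fastforce simp: G_def)
  qed (simp add: G_def)
  have finG: "finite (G k)" for k
    using fin by (rule finite_subset[rotated]) (auto simp: G_def)
  have gap: "Min (G k - G (Suc k)) = a ! k" if "k < n" for k
    using mem[OF that] elts that finG by (intro Min_eqI) auto
  have G0: "G 0 = \<Union>\<K>"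
  proof (cases "n = 0")
    case True
    then show ?thesis using set_a n_def by (simp add: G_def)
  next
    case False
    have "a ! 0 \<le> Min C" if "C \<in> \<K>" for C
      using index[OF that] mono by (metis le_less not_gr_zero)
    then show ?thesis using False by (auto simp: G_def)
  qed
  have Union: "G k = \<Union>{C \<in> \<K>. C \<subseteq> G k}" for k
    by (auto simp: G_def)
  have contain: "a ! k \<in> C" if C: "C \<in> \<K>" "C \<subseteq> G k" "\<not> C \<subseteq> G (Suc k)" and k: "k < n" for C k
  proof -
    have in_C: "Min C \<in> C" using fin_C[OF C(1)] by simp
    then have ge: "a ! k \<le> Min C" using elts C(2) k by blast
    obtain i where i: "i < n" "Min C = a ! i" using index[OF C(1)] by blast
    have "i = k"
    proof (rule ccontr)
      assume "i \<noteq> k"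
      then have "k < i" using ge i mono[of i k] k by (metis linorder_neqE_nat not_le)
      then have "a ! Suc k \<le> a ! i" using mono[of "Suc k" i] i(1) by (cases "Suc k = i") (auto simp: less_imp_le)
      then have "C \<subseteq> G (Suc k)" using \<open>k < i\<close> i C(1) by (auto simp: G_def)
      then show False using C(3) by blast
    qed
    then show ?thesis using i in_C by simp
  qed
  \<comment> \<open>Steps are numbered from 1 but \<open>a\<close> from 0, hence the shift.\<close>
  have gap': "chain_gap (active_chain \<K>) k = a ! (k - 1)" if "k \<in> {1..<n + 1}" for k
  proof -
    obtain j where "k = Suc j" "j < n" using \<open>k \<in> {1..<n + 1}\<close> by (cases k) auto
    then show ?thesis
      using gap[of j] nth[OF Gs, of j] nth[OF Gs, of k] by (simp add: chain_gap_def)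
  qed
  show ?thesis
    unfolding adapted_chain_def decreasing_chain_def chain_step_def
  proof (intro conjI ballI impI)
    show "active_chain \<K> \<noteq> []" "last (active_chain \<K>) = {}" by (simp_all add: Gs G_def)
    show "active_chain \<K> ! 0 = \<Union>\<K>" using nth[OF Gs, of 0] G0 by simp
    show "strict_mono_on {1..<length (active_chain \<K>)} (chain_gap (active_chain \<K>))"
    proof (rule strict_mono_onI)
      fix r s assume "r \<in> {1..<length (active_chain \<K>)}" "s \<in> {1..<length (active_chain \<K>)}" "r < s"
      then have "r \<in> {1..<n + 1}" "s \<in> {1..<n + 1}" "r - 1 < s - 1" "s - 1 < n" by (auto simp: Gs)
      then show "chain_gap (active_chain \<K>) r < chain_gap (active_chain \<K>) s"
        using gap' mono by simp
    qed
  next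
    fix k assume "k \<in> {1..<length (active_chain \<K>)}"
    then obtain j where k: "k = Suc j" "j < n" by (cases k) (auto simp: Gs)
    have nths: "active_chain \<K> ! k = G (Suc j)" "active_chain \<K> ! (k - 1) = G j"
      using k nth[OF Gs] by auto
    show "active_chain \<K> ! k \<subset> active_chain \<K> ! (k - 1)"
      unfolding nths using sub[OF k(2)] mem[OF k(2)] by blast
    show "active_chain \<K> ! (k - 1) = \<Union>{C \<in> \<K>. C \<subseteq> active_chain \<K> ! (k - 1)}"
      unfolding nths by (rule Union)
    fix C assume "C \<in> \<K>" "C \<subseteq> active_chain \<K> ! (k - 1) \<and> \<not> C \<subseteq> active_chain \<K> ! k"
    then show "chain_gap (active_chain \<K>) k \<in> C"
      using contain[of C j] k gap'[of k] unfolding nths by simp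
  qed
qed

text \<open>Since the gaps increase, \<open>p k\<close> is the least element of \<open>G k\<close>.
  A member of \<open>\<K>\<close> that lies in \<open>G k\<close> but not in
  \<open>G (Suc k)\<close> contains \<open>p k\<close>, which is then its minimum. So the gaps are
  the minima of the members, and they determine every \<open>G k\<close>.\<close>

lemma adapted_chain_unique:
  fixes \<K> :: "'a::linorder set set"
  assumes fin: "finite (\<Union>\<K>)" and ne: "{} \<notin> \<K>" and Gs: "adapted_chain \<K> Gs"
  shows "Gs = active_chain \<K>"
proof -
  define n where "n = length Gs - 1"
  define G where "G k = Gs ! k" for k
  define p where "p k = chain_gap Gs (Suc k)" for k
  have len: "length Gs = Suc n" using Gs by (cases Gs) (auto simp: adapted_chain_def decreasing_chain_def n_def)
  have last: "G n = {}"
    using Gs len by (auto simp: adapted_chain_def decreasing_chain_def G_def last_conv_nth)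
  have first: "G 0 = \<Union>\<K>" using Gs by (simp add: adapted_chain_def G_def)
  have p: "p k = Min (G k - G (Suc k))" for k by (simp add: p_def chain_gap_def G_def)
  have step: "G (Suc k) \<subset> G k" "G k = \<Union>{C \<in> \<K>. C \<subseteq> G k}"
      "\<And>C. C \<in> \<K> \<Longrightarrow> C \<subseteq> G k \<Longrightarrow> \<not> C \<subseteq> G (Suc k) \<Longrightarrow> p k \<in> C" if k: "k < n" for k
  proof -
    have Suc_k: "Suc k \<in> {1..<length Gs}" using k len by simp
    have all: "\<forall>k \<in> {1..<length Gs}. Gs ! k \<subset> Gs ! (k - 1)"
        "\<forall>k \<in> {1..<length Gs}. Gs ! (k - 1) = \<Union>{C \<in> \<K>. C \<subseteq> Gs ! (k - 1)} \<and>
          (\<forall>C \<in> \<K>. C \<subseteq> Gs ! (k - 1) \<and> \<not> C \<subseteq> Gs ! k \<longrightarrow> chain_gap Gs k \<in> C)"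
      using Gs unfolding adapted_chain_def decreasing_chain_def chain_step_def by simp_all
    have *: "Gs ! Suc k \<subset> Gs ! (Suc k - 1)"
        "Gs ! (Suc k - 1) = \<Union>{C \<in> \<K>. C \<subseteq> Gs ! (Suc k - 1)}"
        "\<forall>C \<in> \<K>. C \<subseteq> Gs ! (Suc k - 1) \<and> \<not> C \<subseteq> Gs ! Suc k \<longrightarrow> chain_gap Gs (Suc k) \<in> C"
      using bspec[OF all(1) Suc_k] bspec[OF all(2) Suc_k] by blast+
    show "G (Suc k) \<subset> G k" "G k = \<Union>{C \<in> \<K>. C \<subseteq> G k}"
      using *(1,2) by (simp_all add: G_def)
    fix C assume "C \<in> \<K>" "C \<subseteq> G k" "\<not> C \<subseteq> G (Suc k)"
    then show "p k \<in> C" using *(3) by (simp add: G_def p_def)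
  qed
  have mono: "p i < p j" if "i < j" "j < n" for i j
    using Gs that len unfolding adapted_chain_def decreasing_chain_def p_def
    by (auto dest!: strict_mono_onD[of _ _ "Suc i" "Suc j"])
  have antimono: "G j \<subseteq> G i" if "i \<le> j" "j \<le> n" for i j
    using that
  proof (induction j rule: dec_induct)
    case (step m)
    then show ?case using \<open>\<And>k. k < n \<Longrightarrow> G (Suc k) \<subset> G k\<close>[of m] by auto
  qed simp
  have finG: "finite (G k)" if "k \<le> n" for k
    using antimono[of 0 k] that fin first finite_subset by auto
  have fin_C: "finite C" "C \<noteq> {}" if "C \<in> \<K>" for C
    using that ne by (auto intro: finite_subset[OF Union_upper fin])
  have p_in: "p k \<in> G k - G (Suc k)" if "k < n" for k
    unfolding p using finG[of k] step(1)[OF that] that by (intro Min_in) auto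
  \<comment> \<open>Downward induction on \<open>k\<close>: what survives into
    \<open>G (Suc k)\<close> is bounded below by the larger gap \<open>p (Suc k)\<close>.\<close>
  have lower: "p k \<le> x" if "k < n" "x \<in> G k" for k x
    using that
  proof (induction "n - k" arbitrary: k rule: less_induct)
    case less
    show ?case
    proof (cases "x \<in> G (Suc k)")
      case True
      then have "Suc k < n" using last less.prems(1) by (cases "Suc k = n") auto
      then have "p k < p (Suc k)" "p (Suc k) \<le> x"
        using less.hyps[of "Suc k"] True mono[of k "Suc k"] by (simp_all add: diff_less_mono2)
      then show ?thesis by order
    next
      case False
      then show ?thesis unfolding p using less.prems finG[of k] by (intro Min_le) auto
    qed
  qed
  have level: "\<exists>k < n. C \<subseteq> G k \<and> \<not> C \<subseteq> G (Suc k) \<and> Min C = p k" if C: "C \<in> \<K>" for C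
  proof -
    have "\<not> C \<subseteq> G n" using last fin_C[OF C] by simp
    moreover have "C \<subseteq> G 0" using first C by blast
    ultimately obtain k where k: "k < n" "C \<subseteq> G k" "\<not> C \<subseteq> G (Suc k)"
      using ex_least_nat_less[of "\<lambda>k. \<not> C \<subseteq> G k" n] by auto
    then have "Min C = p k"
      using step(3)[OF k(1) C] lower[OF k(1)] fin_C[OF C] by (intro Min_eqI) auto
    then show ?thesis using k by blast
  qed
  have Min_K: "Min ` \<K> = p ` {0..<n}"
  proof
    show "Min ` \<K> \<subseteq> p ` {0..<n}" using level by fastforce
    show "p ` {0..<n} \<subseteq> Min ` \<K>"
    proof
      fix q assume "q \<in> p ` {0..<n}"
      then obtain k where k: "k < n" "q = p k" by auto
      \<comment> \<open>As \<open>G k\<close> is a union of members, one of them contains the gap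
        \<open>p k\<close>.\<close>
      then obtain C where C: "C \<in> \<K>" "C \<subseteq> G k" "p k \<in> C" using p_in step(2) by blast
      then have "Min C = p k" using lower[OF k(1)] fin_C[OF C(1)] by (intro Min_eqI) auto
      then show "q \<in> Min ` \<K>" using C(1) k(2) by (metis imageI)
    qed
  qed
  have a: "sorted_list_of_set (Min ` \<K>) = map p [0..<n]"
  proof -
    have "sorted_wrt (<) (map p [0..<n])" using mono by (simp add: sorted_wrt_iff_nth_less)
    then show ?thesis
      unfolding Min_K by (metis sorted_list_of_set.idem_if_sorted_distinct set_map set_upt strict_sorted_iff)
  qed
  have G_eq: "G k = \<Union>{C \<in> \<K>. p k \<le> Min C}" if k: "k < n" for k
  proof -
    have "C \<subseteq> G k \<longleftrightarrow> p k \<le> Min C" if C: "C \<in> \<K>" for C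
    proof
      assume "C \<subseteq> G k"
      then show "p k \<le> Min C" using lower[OF k] fin_C[OF C] by auto
    next
      assume ge: "p k \<le> Min C"
      obtain j where j: "j < n" "C \<subseteq> G j" "Min C = p j" using level[OF C] by blast
      then have "k \<le> j" using ge mono[of j k] k by (metis not_le)
      then show "C \<subseteq> G k" using j antimono[of k j] by auto
    qed
    then have "{C \<in> \<K>. C \<subseteq> G k} = {C \<in> \<K>. p k \<le> Min C}" by blast
    with step(2)[OF k] show ?thesis by argo
  qed
  show ?thesis
  proof (rule nth_equalityI)
    show "length Gs = length (active_chain \<K>)" by (simp add: active_chain_def a len Let_def)
    fix k assume "k < length Gs"
    then have k: "k < n \<or> k = n" using len by auto
    then show "Gs ! k = active_chain \<K> ! k"
      using G_eq[of k] last unfolding active_chain_def a Let_def G_def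
      by (auto simp del: upt_Suc)
  qed
qed

section \<open>The active filtration\<close>

lemma adapted_chain_iff:
  assumes "finite (\<Union>\<K>)" "{} \<notin> \<K>"
  shows "adapted_chain \<K> Gs \<longleftrightarrow> Gs = active_chain \<K>"
  using active_chain_adapted[OF assms] adapted_chain_unique[OF assms] by blast

lemma active_filtration_eq:
  "active_filtration M = (active_chain (pos_circuits M), \<Union>(pos_circuits M),
     map (\<lambda>G. ground M - G) (active_chain (pos_cocircuits M)))"
  by (simp add: active_filtration_def active_chain_def Let_def active_elts_def dual_active_elts_def
      comp_def if_distrib cong: if_cong)

section \<open>Translating filtrations into chains\<close>

lemma decreasing_list_induct:
  fixes Gs :: "'a set list"
  assumes "Gs \<noteq> []" "P (last Gs)"
    and "\<And>k. k \<in> {1..<length Gs} \<Longrightarrow> P (Gs ! k) \<Longrightarrow> P (Gs ! (k - 1))"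
    and "k < length Gs"
  shows "P (Gs ! k)"
proof -
  have "k \<le> length Gs - 1" using assms(4) by simp
  then show ?thesis
  proof (induction k rule: inc_induct)
    case base
    then show ?case using assms(1,2) by (simp add: last_conv_nth)
  next
    case (step m)
    then show ?case using assms(3)[of "Suc m"] by simp
  qed
qed

text \<open>The equivalence for a step is available only once \<open>P\<close> holds for its smaller
  set. \<open>P\<close> starts at the last set, and under either side of the claim each step passes
  it on to the next larger set.\<close>

lemma all_steps_iff:
  fixes Gs :: "'a set list"
  assumes "Gs \<noteq> []" "P (last Gs)"
    and "\<And>k. k \<in> {1..<length Gs} \<Longrightarrow> P (Gs ! k) \<Longrightarrow> Q k \<longleftrightarrow> P (Gs ! (k - 1)) \<and> R k"
  shows "(\<forall>k \<in> {1..<length Gs}. Q k) \<longleftrightarrow> (\<forall>k \<in> {1..<length Gs}. P (Gs ! (k - 1)) \<and> R k)"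
proof -
  have P: "P (Gs ! k)" if "k < length Gs"
      "(\<forall>k \<in> {1..<length Gs}. Q k) \<or> (\<forall>k \<in> {1..<length Gs}. P (Gs ! (k - 1)) \<and> R k)" for k
    using assms(1,2) _ that(1) by (rule decreasing_list_induct) (use that(2) assms(3) in blast)
  show ?thesis
    using P assms(3) by (metis atLeastLessThan_iff)
qed

lemma decreasing_chain_subset:
  assumes "decreasing_chain Gs" "k < length Gs"
  shows "Gs ! k \<subseteq> Gs ! 0"
  using assms(2)
proof (induction k)
  case (Suc k)
  then have "Gs ! Suc k \<subset> Gs ! (Suc k - 1)"
    using assms(1) unfolding decreasing_chain_def by (metis atLeastLessThan_iff le_add1 plus_1_eq_Suc)
  then show ?case using Suc by auto
qed simp

lemma chain_gap_in:
  assumes "decreasing_chain Gs" "finite (Gs ! 0)" "k \<in> {1..<length Gs}"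
  shows "chain_gap Gs k \<in> Gs ! (k - 1) - Gs ! k"
proof -
  have "k - 1 < length Gs" using assms(3) by auto
  then have "finite (Gs ! (k - 1))"
    using decreasing_chain_subset[OF assms(1)] assms(2) finite_subset by blast
  moreover have "Gs ! k \<subset> Gs ! (k - 1)"
    using assms(1,3) by (simp add: decreasing_chain_def)
  ultimately show ?thesis unfolding chain_gap_def by (intro Min_in) auto
qed

text \<open>Complements make the \<open>Fs\<close> half decreasing and preserve the gaps. They
  forget elements outside \<open>E\<close>, so inclusion in \<open>E\<close> appears as a conjunct;
  in a filtration it follows from \<open>last Fs = E\<close>.\<close>

lemma filtration_iff:
  assumes "finite E"
  shows "filtration E (Fs', Fc, Fs) \<longleftrightarrow>
    decreasing_chain Fs' \<and> decreasing_chain (map (\<lambda>F. E - F) Fs) \<and>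
    Fs' ! 0 = Fc \<and> Fc = Fs ! 0 \<and> (\<forall>F \<in> set Fs. F \<subseteq> E)"
proof -
  let ?Gs = "map (\<lambda>F. E - F) Fs"
  have sub: "\<forall>F \<in> set Fs. F \<subseteq> E"
    if "Fs \<noteq> []" "last Fs = E" "\<forall>k \<in> {1..<length Fs}. Fs ! (k - 1) \<subset> Fs ! k"
  proof -
    have "Fs ! k \<subseteq> E" if "k < length Fs" for k
      using \<open>Fs \<noteq> []\<close> _ _ that
      by (rule decreasing_list_induct) (use \<open>last Fs = E\<close> in simp, use \<open>\<forall>k \<in> {1..<length Fs}. _ k\<close> in blast)
    then show ?thesis by (metis in_set_conv_nth)
  qed
  have "?Gs ! k \<subset> ?Gs ! (k - 1) \<longleftrightarrow> Fs ! (k - 1) \<subset> Fs ! k"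
      "chain_gap ?Gs k = Min (Fs ! k - Fs ! (k - 1))"
    if "\<forall>F \<in> set Fs. F \<subseteq> E" "k \<in> {1..<length Fs}" for k
  proof -
    have F: "Fs ! (k - 1) \<subseteq> E" "Fs ! k \<subseteq> E" using that by auto
    have G: "?Gs ! k = E - Fs ! k" "?Gs ! (k - 1) = E - Fs ! (k - 1)" using that by auto
    show "?Gs ! k \<subset> ?Gs ! (k - 1) \<longleftrightarrow> Fs ! (k - 1) \<subset> Fs ! k"
      unfolding G using F by blast
    have "(E - Fs ! (k - 1)) - (E - Fs ! k) = Fs ! k - Fs ! (k - 1)" using F by blast
    then show "chain_gap ?Gs k = Min (Fs ! k - Fs ! (k - 1))"
      unfolding chain_gap_def G by simp
  qed note step = this
  have "last Fs = E \<longleftrightarrow> last ?Gs = {}" if "\<forall>F \<in> set Fs. F \<subseteq> E" "Fs \<noteq> []"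
    using that last_in_set[OF that(2)] by (auto simp: last_map)
  then have dec: "decreasing_chain ?Gs \<longleftrightarrow> Fs \<noteq> [] \<and> last Fs = E \<and>
     (\<forall>k \<in> {1..<length Fs}. Fs ! (k - 1) \<subset> Fs ! k) \<and>
     strict_mono_on {1..<length Fs} (\<lambda>k. Min (Fs ! k - Fs ! (k - 1)))"
    if "\<forall>F \<in> set Fs. F \<subseteq> E"
    using step[OF that] that unfolding decreasing_chain_def strict_mono_on_def by auto
  show ?thesis
  proof (cases "\<forall>F \<in> set Fs. F \<subseteq> E")
    case True
    then show ?thesis
      unfolding filtration.simps dec[OF True] decreasing_chain_def[of Fs'] chain_gap_def[abs_def]
      by argo
  next
    case False
    then show ?thesis using sub unfolding filtration.simps by argo
  qed
qed

lemma dual_bounded_chain_iff: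
  assumes M: "oriented_matroid M" and Gs: "decreasing_chain Gs" "Gs ! 0 \<subseteq> ground M"
  shows "(\<forall>k \<in> {1..<length Gs}. dual_bounded_wrt (minor M (Gs ! (k - 1)) (Gs ! k)) (chain_gap Gs k))
    \<longleftrightarrow> (\<forall>k \<in> {1..<length Gs}. chain_step (pos_circuits M) Gs k)"
proof -
  interpret oriented_matroid M by fact
  have fin: "finite (Gs ! 0)" using Gs(2) finite_ground by (rule finite_subset)
  show ?thesis
    unfolding chain_step_def pos_vector_iff[symmetric]
  proof (rule all_steps_iff)
    show "Gs \<noteq> []" "pos_vector M (last Gs)"
      using Gs(1) by (auto simp: decreasing_chain_def pos_vector_def)
    fix k assume k: "k \<in> {1..<length Gs}" and vec: "pos_vector M (Gs ! k)"
    have "k - 1 < length Gs" using k by auto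
    then have "Gs ! k \<subseteq> Gs ! (k - 1)" "Gs ! (k - 1) \<subseteq> ground M"
      using Gs k decreasing_chain_subset[OF Gs(1)] unfolding decreasing_chain_def by blast+
    then show "dual_bounded_wrt (minor M (Gs ! (k - 1)) (Gs ! k)) (chain_gap Gs k) \<longleftrightarrow>
        pos_vector M (Gs ! (k - 1)) \<and> (\<forall>C \<in> pos_circuits M.
          C \<subseteq> Gs ! (k - 1) \<and> \<not> C \<subseteq> Gs ! k \<longrightarrow> chain_gap Gs k \<in> C)"
      using dual_bounded_minor_iff chain_gap_in[OF Gs(1) fin k] vec by blast
  qed
qed

lemma bounded_chain_iff:
  assumes M: "oriented_matroid M" and Gs: "decreasing_chain Gs" "Gs ! 0 \<subseteq> ground M"
  shows "(\<forall>k \<in> {1..<length Gs}.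
      bounded_wrt (minor M (ground M - Gs ! k) (ground M - Gs ! (k - 1))) (chain_gap Gs k))
    \<longleftrightarrow> (\<forall>k \<in> {1..<length Gs}. chain_step (pos_cocircuits M) Gs k)"
proof -
  interpret oriented_matroid M by fact
  have fin: "finite (Gs ! 0)" using Gs(2) finite_ground by (rule finite_subset)
  show ?thesis
    unfolding chain_step_def pos_covector_iff[symmetric]
  proof (rule all_steps_iff)
    show "Gs \<noteq> []" "pos_covector M (last Gs)"
      using Gs(1) by (auto simp: decreasing_chain_def pos_covector_def)
    fix k assume k: "k \<in> {1..<length Gs}" and cov: "pos_covector M (Gs ! k)"
    have "k - 1 < length Gs" using k by auto
    then have sub: "Gs ! k \<subseteq> Gs ! (k - 1)" "Gs ! (k - 1) \<subseteq> ground M"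
      using Gs k decreasing_chain_subset[OF Gs(1)] unfolding decreasing_chain_def by blast+
    then have compl: "ground M - (ground M - Gs ! k) = Gs ! k"
        "ground M - (ground M - Gs ! (k - 1)) = Gs ! (k - 1)"
      by blast+
    have "ground M - Gs ! (k - 1) \<subseteq> ground M - Gs ! k" "ground M - Gs ! k \<subseteq> ground M"
        "chain_gap Gs k \<in> (ground M - Gs ! k) - (ground M - Gs ! (k - 1))"
      using sub chain_gap_in[OF Gs(1) fin k] by blast+
    from bounded_minor_iff[OF this] cov
    show "bounded_wrt (minor M (ground M - Gs ! k) (ground M - Gs ! (k - 1))) (chain_gap Gs k) \<longleftrightarrow>
        pos_covector M (Gs ! (k - 1)) \<and> (\<forall>D \<in> pos_cocircuits M.
          D \<subseteq> Gs ! (k - 1) \<and> \<not> D \<subseteq> Gs ! k \<longrightarrow> chain_gap Gs k \<in> D)"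
      unfolding compl by blast
  qed
qed

text \<open>Applied both to \<open>Fs'\<close> and to the complements of \<open>Fs\<close>, this
  confines \<open>Fc\<close> and its complement.\<close>

lemma chain_step_first:
  assumes "decreasing_chain Gs" "\<forall>k \<in> {1..<length Gs}. chain_step \<K> Gs k"
  shows "Gs ! 0 \<subseteq> \<Union>\<K>"
proof (cases "length Gs = 1")
  case True
  then show ?thesis using assms(1) by (auto simp: decreasing_chain_def last_conv_nth)
next
  case False
  moreover have "length Gs \<noteq> 0" using assms(1) by (simp add: decreasing_chain_def)
  ultimately have "1 < length Gs" by linarith
  then have "1 \<in> {1..<length Gs}" by simp
  then have "chain_step \<K> Gs 1" using assms(2) by blast
  then show ?thesis unfolding chain_step_def by auto
qed

section \<open>Existence, uniqueness and connectedness\<close>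

lemma filtration_bounded_iff:
  assumes M: "oriented_matroid M"
  shows "filtration (ground M) (Fs', Fc, Fs) \<and> bounded_minors M (Fs', Fc, Fs) \<longleftrightarrow>
    adapted_chain (pos_circuits M) Fs' \<and> Fc = \<Union>(pos_circuits M) \<and>
    adapted_chain (pos_cocircuits M) (map (\<lambda>F. ground M - F) Fs) \<and> (\<forall>F \<in> set Fs. F \<subseteq> ground M)"
    (is "?L \<longleftrightarrow> ?R")
proof -
  interpret oriented_matroid M by fact
  let ?E = "ground M" and ?Gs = "map (\<lambda>F. ground M - F) Fs"
  have union: "?E - \<Union>(pos_cocircuits M) = \<Union>(pos_circuits M)" "\<Union>(pos_cocircuits M) \<subseteq> ?E"
    using compl_Union_pos_cocircuits pos_cocircuit_pos_covector(1) by (auto simp: pos_covector_def)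
  have dual: "(\<forall>k \<in> {1..<length Fs'}. dual_bounded_wrt (minor M (Fs' ! (k - 1)) (Fs' ! k))
        (Min (Fs' ! (k - 1) - Fs' ! k))) \<longleftrightarrow> (\<forall>k \<in> {1..<length Fs'}. chain_step (pos_circuits M) Fs' k)"
    if "decreasing_chain Fs'" "Fs' ! 0 \<subseteq> ?E"
    using dual_bounded_chain_iff[OF M that] by (simp add: chain_gap_def)
  have primal: "(\<forall>k \<in> {1..<length Fs}. bounded_wrt (minor M (Fs ! k) (Fs ! (k - 1)))
        (Min (Fs ! k - Fs ! (k - 1)))) \<longleftrightarrow> (\<forall>k \<in> {1..<length Fs}. chain_step (pos_cocircuits M) ?Gs k)"
    if "decreasing_chain ?Gs" "\<forall>F \<in> set Fs. F \<subseteq> ?E"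
  proof -
    have "Fs \<noteq> []" using that(1) by (simp add: decreasing_chain_def)
    then have "?Gs ! 0 \<subseteq> ?E" by simp
    moreover have "bounded_wrt (minor M (?E - ?Gs ! k) (?E - ?Gs ! (k - 1))) (chain_gap ?Gs k)
        \<longleftrightarrow> bounded_wrt (minor M (Fs ! k) (Fs ! (k - 1))) (Min (Fs ! k - Fs ! (k - 1)))"
      if k: "k \<in> {1..<length Fs}" for k
    proof -
      have F: "Fs ! (k - 1) \<subseteq> ?E" "Fs ! k \<subseteq> ?E"
        using k \<open>\<forall>F \<in> set Fs. F \<subseteq> ?E\<close> by auto
      have G: "?Gs ! k = ?E - Fs ! k" "?Gs ! (k - 1) = ?E - Fs ! (k - 1)" using k by auto
      have "?E - (?E - Fs ! k) = Fs ! k" "?E - (?E - Fs ! (k - 1)) = Fs ! (k - 1)"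
          "(?E - Fs ! (k - 1)) - (?E - Fs ! k) = Fs ! k - Fs ! (k - 1)"
        using F by blast+
      then show ?thesis unfolding chain_gap_def G by simp
    qed
    ultimately show ?thesis
      using bounded_chain_iff[OF M that(1)] by simp
  qed
  show ?thesis
  proof
    assume L: ?L
    then have F: "decreasing_chain Fs'" "decreasing_chain ?Gs" "Fs' ! 0 = Fc" "Fc = Fs ! 0"
        "\<forall>F \<in> set Fs. F \<subseteq> ?E"
      using iffD1[OF filtration_iff[OF finite_ground] conjunct1[OF L]] by blast+
    have ne: "Fs \<noteq> []" using F(2) by (simp add: decreasing_chain_def)
    then have Fc: "Fc \<subseteq> ?E" "?Gs ! 0 = ?E - Fc" using F(4,5) by auto
    have steps: "\<forall>k \<in> {1..<length Fs'}. chain_step (pos_circuits M) Fs' k"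
        "\<forall>k \<in> {1..<length ?Gs}. chain_step (pos_cocircuits M) ?Gs k"
      using conjunct2[OF L] iffD1[OF dual[OF F(1)]] iffD1[OF primal[OF F(2,5)]] Fc(1)
      unfolding bounded_minors.simps F(3) length_map by blast+
    \<comment> \<open>\<open>Fc\<close> lies in the union of the positive circuits and its
      complement in that of the positive cocircuits. These unions are complementary, so both
      inclusions are equalities.\<close>
    have "Fc \<subseteq> \<Union>(pos_circuits M)" using chain_step_first[OF F(1) steps(1)] F(3) by simp
    moreover have "?E - Fc \<subseteq> \<Union>(pos_cocircuits M)"
      using chain_step_first[OF F(2) steps(2)] Fc(2) by simp
    ultimately have "Fc = \<Union>(pos_circuits M)" "?E - Fc = \<Union>(pos_cocircuits M)"
      using union Fc(1) by blast+
    then show ?R unfolding adapted_chain_def using F steps Fc(2) by simp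
  next
    assume R: ?R
    then have F: "decreasing_chain Fs'" "decreasing_chain ?Gs" "\<forall>F \<in> set Fs. F \<subseteq> ?E"
        "Fs' ! 0 = Fc" "?Gs ! 0 = \<Union>(pos_cocircuits M)"
      and steps: "\<forall>k \<in> {1..<length Fs'}. chain_step (pos_circuits M) Fs' k"
        "\<forall>k \<in> {1..<length ?Gs}. chain_step (pos_cocircuits M) ?Gs k"
      unfolding adapted_chain_def by auto
    have "Fs \<noteq> []" using F(2) by (simp add: decreasing_chain_def)
    then have "Fs ! 0 \<subseteq> ?E" "?Gs ! 0 = ?E - Fs ! 0" using F(3) by auto
    then have "Fs ! 0 = ?E - \<Union>(pos_cocircuits M)" using F(5) by auto
    moreover have "Fc = \<Union>(pos_circuits M)" using R by blast
    ultimately have "Fs ! 0 = Fc" "Fc \<subseteq> ?E" using union(1) \<open>Fs ! 0 \<subseteq> ?E\<close> by simp_all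
    then have "bounded_minors M (Fs', Fc, Fs)"
      using steps iffD2[OF dual[OF F(1)]] iffD2[OF primal[OF F(2,3)]]
      unfolding bounded_minors.simps F(4) length_map by blast
    moreover have "filtration ?E (Fs', Fc, Fs)"
      using \<open>Fs ! 0 = Fc\<close> F by (intro iffD2[OF filtration_iff[OF finite_ground]]) simp
    ultimately show ?L by (rule conjI[rotated])
  qed
qed

lemma filtration_bounded_unique:
  assumes M: "oriented_matroid (M :: 'a::linorder om)"
  shows "filtration (ground M) \<F> \<and> bounded_minors M \<F> \<longleftrightarrow> \<F> = active_filtration M"
proof -
  interpret oriented_matroid M by fact
  obtain Fs' Fc Fs where \<F>: "\<F> = (Fs', Fc, Fs)" by (cases \<F>)
  let ?c = "\<lambda>F. ground M - F"
  have pc: "finite (\<Union>(pos_circuits M))" "{} \<notin> pos_circuits M"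
    using pos_circuit_ground finite_ground by (auto intro: finite_subset[OF Union_least])
  have pcc: "\<Union>(pos_cocircuits M) \<subseteq> ground M" "{} \<notin> pos_cocircuits M"
    using pos_cocircuit_pos_covector(1) pos_cocircuit_pos_covector(2)[of "{}"]
    by (auto simp: pos_covector_def)
  then have fin: "finite (\<Union>(pos_cocircuits M))" using finite_ground finite_subset by blast
  let ?D = "active_chain (pos_cocircuits M)"
  have D: "G \<subseteq> ground M" if "G \<in> set ?D" for G
    using that pcc(1) by (auto simp: active_chain_def Let_def split: if_splits)
  \<comment> \<open>Complementation is an involution on lists of subsets of the ground set, so
    \<open>Fs\<close> and its chain of complements determine each other.\<close>
  have "(map ?c Fs = ?D \<and> (\<forall>F \<in> set Fs. F \<subseteq> ground M)) \<longleftrightarrow> Fs = map ?c ?D"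
  proof
    assume *: "map ?c Fs = ?D \<and> (\<forall>F \<in> set Fs. F \<subseteq> ground M)"
    then have "map ?c (map ?c Fs) = Fs" unfolding map_map by (intro map_idI) auto
    then show "Fs = map ?c ?D" using * by simp
  next
    assume *: "Fs = map ?c ?D"
    have "map ?c (map ?c ?D) = ?D" unfolding map_map using D by (intro map_idI) auto
    then show "map ?c Fs = ?D \<and> (\<forall>F \<in> set Fs. F \<subseteq> ground M)" using * by auto
  qed
  then show ?thesis
    unfolding \<F> filtration_bounded_iff[OF M] active_filtration_eq
      adapted_chain_iff[OF pc] adapted_chain_iff[OF fin pcc(2)] by auto
qed

lemma bounded_filtration_connected:
  assumes M: "oriented_matroid M" and "filtration (ground M) \<F>" "bounded_minors M \<F>"
  shows "connected_filtration M \<F>"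
proof -
  obtain Fs' Fc Fs where \<F>: "\<F> = (Fs', Fc, Fs)" by (cases \<F>)
  have minor: "oriented_matroid (minor M A B)" for A B
    using oriented_matroid.oriented_matroid_minor[OF M] .
  show ?thesis
    using assms(2,3) oriented_matroid.bounded_connected[OF minor]
      oriented_matroid.dual_bounded_connected[OF minor]
    unfolding \<F> connected_filtration.simps bounded_minors.simps by blast
qed

theorem theorem4p4:
  fixes M :: "'a::linorder om"
  assumes "oriented_matroid M"
  shows "connected_filtration M (active_filtration M) \<and>
    (\<forall>\<F>. filtration (ground M) \<F> \<and> bounded_minors M \<F> \<longleftrightarrow> \<F> = active_filtration M) \<and>
    (\<forall>\<F>. connected_filtration M \<F> \<and> bounded_minors M \<F> \<longleftrightarrow> \<F> = active_filtration M)"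
proof -
  have "connected_filtration M \<F> \<Longrightarrow> filtration (ground M) \<F>" for \<F>
    by (cases \<F>) simp
  then show ?thesis
    using filtration_bounded_unique[OF assms] bounded_filtration_connected[OF assms] by metis
qed

end
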